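(* Let $a,b$ be positive integers with $a\le b$. Every nonnegative integer can be written as $ax^2+by^2+3(z^2+zw+w^2)$ with $x,y,z,w\in\mathbb{Z}$ if and only if $a=1$ and $b=2$. *)

theory Defs
  imports Main
begin

end

theory Submission
  imports
    Defs
    "HOL-Number_Theory.Number_Theory"
    "HOL-Computational_Algebra.Squarefree"
begin

text \<open>
  Representing \<open>1\<close>, \<open>2\<close> and \<open>6\<close> forces \<open>a = 1\<close> and \<open>b = 2\<close>. Conversely, the numbers represented by
  \<open>x\<^sup>2 + 2y\<^sup>2 + 3(z\<^sup>2 + zw + w\<^sup>2)\<close> are closed under multiplication by \<open>3\<close>, and \<open>z\<^sup>2 + zw + w\<^sup>2\<close> takes the
  values \<open>u\<^sup>2\<close> and \<open>u\<^sup>2 + 3\<close>. Subtracting \<open>9\<close> from even numbers, it suffices that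
  \<open>x\<^sup>2 + 2y\<^sup>2 + 3z\<^sup>2\<close> represents every odd squarefree \<open>n > 0\<close> prime to \<open>3\<close>.

  In the style of Ankeny's proof of the three squares theorem, choose a prime \<open>q\<close> such that \<open>-6n\<close> is
  a square modulo \<open>q\<close> and \<open>-q\<close> is a square modulo each prime factor of \<open>n\<close>. With
  \<open>b\<^sup>2 + 6n = q h\<close> and \<open>n\<close> dividing \<open>q t\<^sup>2 + 1\<close>, the form
  \<open>(t(qx + by) + nz)\<^sup>2 + qx\<^sup>2 + 2bxy + hy\<^sup>2\<close> is \<open>n\<close> times an odd positive integral form of determinant
  \<open>6\<close>. By Hermite reduction such a form represents \<open>1\<close>, so \<open>n = R\<^sup>2 + v\<close>. The conditions on \<open>q\<close>
  make \<open>-6\<close> a square modulo every prime that divides \<open>v\<close> to an odd power, so \<open>v\<close> is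
  represented by \<open>x\<^sup>2 + 6y\<^sup>2\<close> or \<open>2x\<^sup>2 + 3y\<^sup>2\<close>, and \<open>q \<equiv> 2\<close> modulo \<open>3\<close> excludes the former.

  The prime \<open>q\<close> is only constrained by quadratic characters, so Dirichlet's theorem is needed
  only for real characters, where Mertens' elementary method suffices.
\<close>

section \<open>Positive forms of determinant 6\<close>

lemma nearest_multiple:
  fixes m h :: int
  assumes "m > 0"
  obtains j where "\<bar>2 * (h + j * m)\<bar> \<le> m"
proof
  have "2 * h + m = (2 * m) * ((2 * h + m) div (2 * m)) + (2 * h + m) mod (2 * m)"
    by simp
  moreover have "0 \<le> (2 * h + m) mod (2 * m)" "(2 * h + m) mod (2 * m) < 2 * m"
    using assms by simp_all
  ultimately show "\<bar>2 * (h + (- ((2 * h + m) div (2 * m))) * m)\<bar> \<le> m"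
    by (simp add: algebra_simps abs_if)
qed

text \<open>Chinese remaindering, one prime at a time: squarefreeness keeps each prime coprime to
  the remaining cofactor.\<close>

lemma square_mod_squarefree:
  fixes n D :: int
  assumes "squarefree n" and "\<And>p. prime p \<Longrightarrow> p dvd n \<Longrightarrow> \<exists>s. p dvd s^2 - D"
  shows "\<exists>s. n dvd s^2 - D"
  using assms
proof (induction n rule: prime_divisors_induct)
  case zero
  then show ?case by simp
next
  case (unit u)
  then show ?case using unit_imp_dvd by blast
next
  case (factor p x)
  have "coprime p x"
  proof (rule prime_imp_coprime[OF factor.hyps])
    show "\<not> p dvd x"
      using factor.prems(1) factor.hyps
      by (metis dvd_refl mult_dvd_mono not_prime_unit power2_eq_square squarefreeD)
  qed
  moreover have "squarefree x"
    using factor.prems(1) squarefree_multD(2) by blast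
  then obtain s where s: "x dvd s^2 - D"
    using factor by (meson dvd_mult)
  obtain r where r: "p dvd r^2 - D"
    using factor.prems(2)[OF factor.hyps] by auto
  obtain t where t: "[t = r] (mod p)" "[t = s] (mod x)"
    using binary_chinese_remainder_int[OF \<open>coprime p x\<close>] by blast
  have "p dvd t^2 - D"
    by (metis cong_iff_dvd_diff cong_pow cong_trans r t(1))
  moreover have "x dvd t^2 - D"
    by (metis cong_iff_dvd_diff cong_pow cong_trans s t(2))
  ultimately show ?case
    by (meson divides_mult)
qed

text \<open>Gauss reduction, by induction on the leading coefficient: a shift makes
  \<open>2 * b'\<close> at most \<open>a\<close> in absolute value, and a swap lowers
  \<open>a\<close> as long as \<open>c' < a\<close>. A reduced form has
  \<open>3 * a^2 \<le> 24\<close>, which leaves two forms.\<close>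

lemma binary_form_det_6:
  fixes a b c :: int
  assumes "a > 0" "a * c - b^2 = 6"
  shows "\<exists>x y. a * u^2 + 2 * b * u * v + c * v^2 = x^2 + 6 * y^2 \<or>
               a * u^2 + 2 * b * u * v + c * v^2 = 2 * x^2 + 3 * y^2"
  using assms
proof (induction "nat a" arbitrary: a b c u v rule: less_induct)
  case less
  obtain j where j: "\<bar>2 * (b + j * a)\<bar> \<le> a"
    using nearest_multiple less.prems(1) by blast
  define b' c' u' where "b' = b + j * a" and "c' = c + 2 * j * b + j^2 * a" and "u' = u - j * v"
  have eq: "a * u^2 + 2 * b * u * v + c * v^2 = a * u'^2 + 2 * b' * u' * v + c' * v^2"
    unfolding b'_def c'_def u'_def by (simp add: power2_eq_square algebra_simps)
  have det: "a * c' - b'^2 = 6"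
    using less.prems(2) unfolding b'_def c'_def by (simp add: power2_eq_square algebra_simps)
  have b': "\<bar>2 * b'\<bar> \<le> a"
    using j by (simp add: b'_def)
  have "a * c' > 0"
    using det by (smt (verit) zero_le_power2)
  then have "c' > 0"
    using less.prems(1) by (simp add: zero_less_mult_iff)
  show ?case
  proof (cases "c' < a")
    case True
    have "\<exists>x y. c' * v^2 + 2 * b' * v * u' + a * u'^2 = x^2 + 6 * y^2 \<or>
                c' * v^2 + 2 * b' * v * u' + a * u'^2 = 2 * x^2 + 3 * y^2"
      by (rule less.hyps) (use True \<open>c' > 0\<close> det in \<open>auto simp: mult.commute\<close>)
    then show ?thesis
      unfolding eq by (simp add: algebra_simps)
  next
    case False
    have "(2 * b')^2 \<le> a^2"
      using b' by (metis abs_le_square_iff abs_of_pos less.prems(1))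
    moreover have "a * a \<le> a * c'"
      using False less.prems(1) by simp
    ultimately have "3 * a^2 \<le> 24"
      using det by (simp add: power2_eq_square)
    moreover have "a^2 \<ge> 9" if "a \<ge> 3"
      using power_mono[OF that, of 2] by simp
    ultimately have "a = 1 \<or> a = 2"
      using less.prems(1) by linarith
    then show ?thesis
    proof
      assume "a = 1"
      then have "b' = 0" using b' by auto
      then show ?thesis using det \<open>a = 1\<close> unfolding eq by auto
    next
      assume "a = 2"
      then have "b' = 0 \<or> b' = 1 \<or> b' = -1" using b' by auto
      \<comment> \<open>\<open>b' = 1\<close> or \<open>b' = -1\<close> would give
        \<open>2 * c' = 7\<close>.\<close>
      then have "b' = 0" using det \<open>a = 2\<close> by (auto; presburger)
      then show ?thesis using det \<open>a = 2\<close> unfolding eq by auto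
    qed
  qed
qed

text \<open>Hermite reduction, by lexicographic induction on the leading coefficient and the leading
  2 by 2 minor. Reduced forms have \<open>a \<le> 2\<close>, and for \<open>a = 2\<close> all
  diagonal coefficients come out even. The parity condition is preserved by the reduction and rules
  this out: \<open>2 * x^2 + 2 * y^2 + 2 * z^2 + 2 * x * y\<close> has determinant 6 but takes only
  even values.\<close>

lemma ternary_form_det_6:
  fixes a b c d e f :: int
  assumes "a > 0" "a * b - f^2 > 0" "a * b * c + 2 * d * e * f - a * d^2 - b * e^2 - c * f^2 = 6"
    and "odd a \<or> odd b \<or> odd c"
  shows "\<exists>x y z. a * x^2 + b * y^2 + c * z^2 + 2 * d * y * z + 2 * e * x * z + 2 * f * x * y = 1"
  using assms
proof (induction "(nat a, nat (a * b - f^2))" arbitrary: a b c d e f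
    rule: wf_induct_rule[OF wf_lex_prod[OF wf_less_than wf_less_than]])
  case (1 a b f c d e)
  define A where "A = a * b - f^2"
  have A: "A > 0" using 1 by (simp add: A_def)
  obtain l where l: "\<bar>2 * ((a * d - e * f) + l * A)\<bar> \<le> A"
    using nearest_multiple[OF A] by blast
  obtain j where j: "\<bar>2 * (f + j * a)\<bar> \<le> a"
    using nearest_multiple 1 by blast
  obtain k where k: "\<bar>2 * ((e + f * l) + k * a)\<bar> \<le> a"
    using nearest_multiple 1 by blast
  \<comment> \<open>Coefficients after replacing \<open>x\<close> by
    \<open>x + j * y + k * z\<close> and \<open>y\<close> by \<open>y + l * z\<close>. Completing
    the square in \<open>x\<close> leaves the binary form with coefficients \<open>A\<close>,
    \<open>H\<close>, \<open>B\<close>, of determinant \<open>6 * a\<close>; \<open>j\<close>,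
    \<open>k\<close>, \<open>l\<close> make both levels nearly diagonal.\<close>
  define b' f' e' where "b' = b + 2 * f * j + a * j^2" and "f' = f + j * a"
    and "e' = (e + f * l) + k * a"
  define d' where "d' = d + b * l + (e + f * l) * j + f' * k"
  define c' where "c' = c + 2 * d * l + b * l^2 + 2 * (e + f * l) * k + a * k^2"
  define B H where "B = a * c' - e'^2" and "H = a * d' - e' * f'"
  have A': "a * b' - f'^2 = A"
    unfolding A_def b'_def f'_def by (simp add: power2_eq_square algebra_simps)
  have H': "H = (a * d - e * f) + l * A"
    unfolding H_def A_def d'_def e'_def f'_def by (simp add: power2_eq_square algebra_simps)
  have det: "a * b' * c' + 2 * d' * e' * f' - a * d'^2 - b' * e'^2 - c' * f'^2 = 6"
    using 1(4) unfolding b'_def c'_def d'_def e'_def f'_def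
    by (simp add: power2_eq_square algebra_simps)
  have AB: "A * B - H^2 = 6 * a"
  proof -
    have "A * B - H^2 = a * (a * b' * c' + 2 * d' * e' * f' - a * d'^2 - b' * e'^2 - c' * f'^2)"
      unfolding A'[symmetric] B_def H_def by (simp add: power2_eq_square algebra_simps)
    then show ?thesis using det by simp
  qed
  have par: "odd a \<or> odd b' \<or> odd c'"
    using 1(5) unfolding b'_def c'_def by auto
  have eq: "a * x^2 + b' * y^2 + c' * z^2 + 2 * d' * y * z + 2 * e' * x * z + 2 * f' * x * y =
     a * (x + j * y + k * z)^2 + b * (y + l * z)^2 + c * z^2 + 2 * d * (y + l * z) * z
       + 2 * e * (x + j * y + k * z) * z + 2 * f * (x + j * y + k * z) * (y + l * z)" for x y z
    unfolding b'_def c'_def d'_def e'_def f'_def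
    by (simp add: power2_eq_square algebra_simps)
  have bounds: "\<bar>2 * H\<bar> \<le> A" "\<bar>2 * f'\<bar> \<le> a" "\<bar>2 * e'\<bar> \<le> a"
    using l j k unfolding H' f'_def e'_def by simp_all
  have "a > 0" by (fact 1)
  have "A * B > 0"
    using AB \<open>a > 0\<close> by (smt (verit) zero_le_power2)
  then have "B > 0"
    using A by (simp add: zero_less_mult_iff)
  have "a * b' > 0"
    using A A' by (smt (verit) zero_le_power2)
  then have "b' > 0"
    using \<open>a > 0\<close> by (simp add: zero_less_mult_iff)
  have "\<exists>x y z. a * x^2 + b' * y^2 + c' * z^2 + 2 * d' * y * z + 2 * e' * x * z + 2 * f' * x * y = 1"
  proof -
    \<comment> \<open>Exchanging \<open>x\<close> and \<open>y\<close> lowers \<open>a\<close>;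
      exchanging \<open>y\<close> and \<open>z\<close> keeps \<open>a\<close> and lowers the minor
      from \<open>A\<close> to \<open>B\<close>.\<close>
    consider (swap1) "b' < a" | (swap2) "B < A" | (reduced) "a \<le> b'" "A \<le> B"
      by linarith
    then show ?thesis
    proof cases
      case swap1
      have "\<exists>x y z. b' * x^2 + a * y^2 + c' * z^2 + 2 * e' * y * z + 2 * d' * x * z + 2 * f' * x * y = 1"
        by (rule 1(1)) (use swap1 \<open>b' > 0\<close> A A' det par in \<open>auto simp: algebra_simps\<close>)
      then obtain x y z where
        "b' * x^2 + a * y^2 + c' * z^2 + 2 * e' * y * z + 2 * d' * x * z + 2 * f' * x * y = 1"
        by blast
      then show ?thesis
        by (intro exI[of _ y] exI[of _ x] exI[of _ z]) (simp add: algebra_simps)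
    next
      case swap2
      have "\<exists>x y z. a * x^2 + c' * y^2 + b' * z^2 + 2 * d' * y * z + 2 * f' * x * z + 2 * e' * x * y = 1"
        by (rule 1(1))
           (use swap2 \<open>a > 0\<close> \<open>B > 0\<close> det par in \<open>auto simp: A_def B_def algebra_simps\<close>)
      then obtain x y z where
        "a * x^2 + c' * y^2 + b' * z^2 + 2 * d' * y * z + 2 * f' * x * z + 2 * e' * x * y = 1"
        by blast
      then show ?thesis
        by (intro exI[of _ x] exI[of _ z] exI[of _ y]) (simp add: algebra_simps)
    next
      case reduced
      have "(2 * f')^2 \<le> a^2"
        using bounds \<open>a > 0\<close> by (metis abs_le_square_iff abs_of_pos)
      moreover have "a * a \<le> a * b'"
        using reduced \<open>a > 0\<close> by simp
      ultimately have A3: "4 * A \<ge> 3 * a^2"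
        unfolding A'[symmetric] by (simp add: power2_eq_square)
      have "(2 * H)^2 \<le> A^2"
        using bounds A by (metis abs_le_square_iff abs_of_pos)
      moreover have "A * A \<le> A * B"
        using reduced A by simp
      ultimately have A2: "3 * A^2 \<le> 24 * a"
        using AB by (simp add: power2_eq_square)
      have "a \<le> 2"
      proof (rule ccontr)
        assume "\<not> a \<le> 2"
        then have "a \<ge> 3" by simp
        then have "3 * (3 * a) \<le> 3 * a^2"
          by (simp add: power2_eq_square)
        then have "4 * A \<ge> 9 * a" using A3 by linarith
        then have "(4 * A)^2 \<ge> (9 * a)^2"
          using \<open>a > 0\<close> by (intro power_mono) auto
        moreover have "a^2 \<ge> 3 * a"
          using \<open>a \<ge> 3\<close> by (simp add: power2_eq_square)
        ultimately show False using A2 \<open>a > 0\<close> by (simp add: power_mult_distrib)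
      qed
      then consider "a = 1" | "a = 2" using \<open>a > 0\<close> by linarith
      then show ?thesis
      proof cases
        assume "a = 1"
        then show ?thesis by (intro exI[of _ 1] exI[of _ 0]) simp
      next
        assume a: "a = 2"
        have "A^2 \<ge> 25" if "A \<ge> 5"
          using power_mono[OF that, of 2] by simp
        then have "A = 3 \<or> A = 4"
          using A2 A3 a by fastforce
        have f': "f' = 0 \<or> f' = 1 \<or> f' = -1" and e': "e' = 0 \<or> e' = 1 \<or> e' = -1"
          using bounds a by auto
        \<comment> \<open>The possible \<open>A\<close> are tested in
          \<open>A * B = 12 + H^2\<close> and \<open>A = 2 * b' - f'^2\<close>; for
          \<open>A = 4\<close>, the solution \<open>B = 3\<close> violates
          \<open>A \<le> B\<close>.\<close>
        have "B = 4 \<and> even b'"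
          using \<open>A = 3 \<or> A = 4\<close>
        proof
          assume "A = 3"
          then have "H = 0 \<or> H = 1 \<or> H = -1"
            using bounds by auto
          then have "B = 4"
            using AB \<open>A = 3\<close> a by (auto; presburger)
          then show ?thesis
            using A' \<open>A = 3\<close> a f' by (auto; presburger)
        next
          assume "A = 4"
          then have "H = 0 \<or> H = 1 \<or> H = -1 \<or> H = 2 \<or> H = -2"
            using bounds by auto
          then have "B = 4"
            using AB \<open>A = 4\<close> a reduced by (auto; presburger)
          moreover have "even b'"
            using A' \<open>A = 4\<close> a f' by (auto; presburger)
          ultimately show ?thesis by simp
        qed
        moreover have "even c'"
          using calculation e' a unfolding B_def by (auto; presburger)
        ultimately show ?thesis
          using par a by auto
      qed
    qed
  qed
  then show ?case unfolding eq by blast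
qed

section \<open>Quadratic residue conditions, and the passage from the prime \<open>q\<close> to the
  ternary form\<close>

lemma inverse_mod_coprime:
  fixes y n :: int
  assumes "coprime y n"
  obtains w where "n dvd y * w - 1"
  using cong_solve_coprime_int[OF assms] by (auto simp: cong_iff_dvd_diff)

lemma square_mod_divide:
  fixes p D r y :: int
  assumes "coprime y p" "p dvd r^2 + D * y^2"
  shows "\<exists>t. p dvd t^2 + D"
proof -
  obtain w where w: "p dvd y * w - 1"
    using inverse_mod_coprime assms(1) by blast
  have "(r * w)^2 + D = w^2 * (r^2 + D * y^2) - (y * w - 1) * ((y * w + 1) * D)"
    by (simp add: power2_eq_square algebra_simps)
  then show ?thesis
    using assms(2) w by (metis dvd_diff dvd_mult dvd_mult2)
qed

text \<open>Descent on \<open>k\<close>: if \<open>p\<close> divides \<open>y\<close>, it also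
  divides \<open>x\<close> and \<open>k\<close>, and all three can be divided by \<open>p\<close>.
  Otherwise \<open>y\<close> is invertible modulo \<open>p\<close>, and \<open>x / y\<close> is the
  root.\<close>

lemma square_mod_of_odd_multiplicity:
  fixes p D w x y k :: int
  assumes "prime p" "\<not> p dvd w" "k \<noteq> 0" "x^2 + D * y^2 = p * w * k^2"
  shows "\<exists>t. p dvd t^2 + D"
  using assms(3,4)
proof (induction "nat \<bar>k\<bar>" arbitrary: x y k rule: less_induct)
  case less
  show ?case
  proof (cases "p dvd y")
    case False
    then have "coprime y p"
      using assms(1) by (simp add: coprime_commute prime_imp_coprime)
    moreover have "p dvd x^2 + D * y^2"
      using less.prems(2) by simp
    ultimately show ?thesis by (rule square_mod_divide)
  next
    case True
    then obtain y' where y': "y = p * y'" ..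
    have "x^2 = p * (w * k^2 - D * p * y'^2)"
      using less.prems(2) unfolding y' by (simp add: power2_eq_square algebra_simps)
    then have "p dvd x^2" by simp
    then obtain x' where x': "x = p * x'"
      using assms(1) prime_dvd_power by blast
    have "p * (p * (x'^2 + D * y'^2)) = p * (w * k^2)"
      using less.prems(2) unfolding x' y' by (simp add: power2_eq_square algebra_simps)
    then have eq: "p * (x'^2 + D * y'^2) = w * k^2"
      using assms(1) by simp
    then have "p dvd w * k^2"
      by (metis dvd_triv_left)
    then have "p dvd k"
      using assms(1,2) by (metis prime_dvd_multD prime_dvd_power)
    then obtain k' where k': "k = p * k'" ..
    have "p * (x'^2 + D * y'^2) = p * (p * w * k'^2)"
      using eq unfolding k' by (simp add: power2_eq_square algebra_simps)
    then have "x'^2 + D * y'^2 = p * w * k'^2"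
      using assms(1) by simp
    moreover have "k' \<noteq> 0"
      using k' less.prems(1) by auto
    moreover have "\<bar>k'\<bar> < \<bar>k\<bar>"
      using k' \<open>k' \<noteq> 0\<close> prime_gt_1_int[OF assms(1)] by (simp add: abs_mult)
    ultimately show ?thesis
      by (intro less.hyps[of k' x' y']) auto
  qed
qed

lemma square_mod_3: "(x::int)^2 mod 3 = (if 3 dvd x then 0 else 1)"
proof -
  have "x mod 3 = 0 \<or> x mod 3 = 1 \<or> x mod 3 = 2" by presburger
  then show ?thesis
    by (auto simp: dvd_eq_mod_eq_0 power2_eq_square mod_mult_eq[of x 3 x, symmetric])
qed

text \<open>Anisotropy over the 3-adic numbers, by descent. Modulo 3 the equation reads
  \<open>2 * x^2 = z^2\<close>, so 3 divides \<open>x\<close> and \<open>z\<close> because 2 is not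
  a square. After division by 3 the same argument applies to \<open>y\<close> and \<open>w\<close>,
  and the value drops by a factor 9.\<close>

lemma anisotropic_at_3:
  fixes q n :: int
  assumes "q mod 3 = 2" "n mod 3 = 1" "q * (x^2 + 6 * y^2) = z^2 + 6 * n * w^2"
  shows "x^2 + 6 * y^2 = 0"
  using assms(3)
proof (induction "nat (x^2 + 6 * y^2)" arbitrary: x y z w rule: less_induct)
  case less
  obtain k where q: "q = 3 * k + 2" using assms(1) by (metis mult.commute div_mult_mod_eq)
  obtain j where n: "n = 3 * j + 1" using assms(2) by (metis mult.commute div_mult_mod_eq)
  have "2 * x^2 - z^2 = 3 * (2 * n * w^2 - 2 * q * y^2 - k * x^2)"
    using less.prems q by (simp add: algebra_simps)
  then have "(2 * x^2 - z^2) mod 3 = 0" by simp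
  then have "3 dvd x" "3 dvd z"
    using square_mod_3[of x] square_mod_3[of z] by (auto split: if_splits; presburger)+
  then obtain x' z' where x': "x = 3 * x'" and z': "z = 3 * z'" by (elim dvdE)
  have eq: "3 * (q * x'^2) + 2 * (q * y^2) = 3 * z'^2 + 2 * (n * w^2)"
    using less.prems unfolding x' z' by (simp add: power2_eq_square algebra_simps)
  have "4 * y^2 - 2 * w^2 = 3 * (z'^2 + 2 * j * w^2 - 2 * k * y^2 - q * x'^2)"
    using eq q n by (simp add: algebra_simps)
  then have "(4 * y^2 - 2 * w^2) mod 3 = 0" by simp
  then have "3 dvd y" "3 dvd w"
    using square_mod_3[of y] square_mod_3[of w] by (auto split: if_splits; presburger)+
  then obtain y' w' where y': "y = 3 * y'" and w': "w = 3 * w'" by (elim dvdE)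
  have *: "x^2 + 6 * y^2 = 9 * (x'^2 + 6 * y'^2)"
    unfolding x' y' by (simp add: power2_eq_square)
  have "q * (x'^2 + 6 * y'^2) = z'^2 + 6 * n * w'^2"
    using eq unfolding y' w' by (simp add: power2_eq_square algebra_simps)
  then have "x'^2 + 6 * y'^2 = 0" if "nat (x'^2 + 6 * y'^2) < nat (x^2 + 6 * y^2)"
    using less.hyps that by blast
  then have "nat (9 * (x'^2 + 6 * y'^2)) \<le> nat (x'^2 + 6 * y'^2)" if "x'^2 + 6 * y'^2 \<noteq> 0"
    using that unfolding * by (meson not_le)
  moreover have "x'^2 + 6 * y'^2 \<ge> 0" by simp
  ultimately have "x'^2 + 6 * y'^2 = 0"
    by (smt (verit) nat_le_eq_zle)
  then show ?case unfolding * by simp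
qed

text \<open>With \<open>s\<close> the squarefree part and \<open>r^2 + 6 = s * c\<close>, the binary
  form with coefficients \<open>s\<close>, \<open>r\<close>, \<open>c\<close> has determinant 6 and
  takes the value \<open>s\<close> at \<open>(1, 0)\<close>.\<close>

lemma form_1_6_or_2_3:
  fixes v :: int
  assumes "v > 0"
    and "\<And>p. prime p \<Longrightarrow> p dvd squarefree_part v \<Longrightarrow> \<exists>r. p dvd r^2 + 6"
  shows "\<exists>x y. v = x^2 + 6 * y^2 \<or> v = 2 * x^2 + 3 * y^2"
proof -
  define s where "s = squarefree_part v"
  define m where "m = square_part v"
  have v: "v = s * m^2"
    unfolding s_def m_def by (rule squarefree_decompose)
  have "s > 0"
    using assms(1) unfolding v by (simp add: zero_less_mult_iff)
  have "squarefree s"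
    unfolding s_def by (rule squarefree_squarefree_part)
  then obtain r where "s dvd r^2 - (-6)"
    using square_mod_squarefree[of s "-6"] assms(2) unfolding s_def by auto
  then obtain c where "r^2 - (-6) = s * c" ..
  then have "s * c - r^2 = 6" by simp
  from binary_form_det_6[OF \<open>s > 0\<close> this, of 1 0]
  obtain x y where "s = x^2 + 6 * y^2 \<or> s = 2 * x^2 + 3 * y^2" by auto
  then have "v = (x * m)^2 + 6 * (y * m)^2 \<or> v = 2 * (x * m)^2 + 3 * (y * m)^2"
    unfolding v by (auto simp: power_mult_distrib algebra_simps)
  then show ?thesis by blast
qed

lemma form_1_2_3_from_prime:
  fixes n q b :: int
  assumes "n > 0" "odd n" "squarefree n" "\<not> 3 dvd n"
    and q: "prime q" "odd q" "q mod 3 = 2" "\<not> q dvd n" "q dvd b^2 + 6 * n"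
    and res: "\<And>p. prime p \<Longrightarrow> p dvd n \<Longrightarrow> \<exists>s. p dvd s^2 + q"
  shows "\<exists>x y z. n = x^2 + 2 * y^2 + 3 * z^2"
proof -
  have "q > 0" using q(1) by (simp add: prime_gt_0_int)
  have "coprime q n"
    using q by (simp add: prime_imp_coprime)
  obtain s where s: "n dvd s^2 + q"
    using square_mod_squarefree[of n "-q"] assms(3) res by auto
  have "coprime (s^2) n"
  proof (rule coprimeI)
    fix c assume "c dvd s^2" "c dvd n"
    then have "c dvd q"
      using s by (meson dvd_add_right_iff dvd_trans)
    then show "is_unit c"
      using \<open>coprime q n\<close> \<open>c dvd n\<close> by (meson coprime_common_divisor)
  qed
  then have "coprime s n" by simp
  then obtain t where t: "n dvd s * t - 1"
    using inverse_mod_coprime by blast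
  have "q * t^2 + 1 = t^2 * (s^2 + q) - (s * t - 1) * (s * t + 1)"
    by (simp add: power2_eq_square algebra_simps)
  then have "n dvd q * t^2 + 1"
    using s t by (metis dvd_diff dvd_mult dvd_mult2)
  then obtain k where k: "q * t^2 + 1 = n * k" ..
  obtain h where h: "b^2 + 6 * n = q * h"
    using q(5) ..
  \<comment> \<open>Modulo \<open>n\<close>, \<open>q * h\<close> is \<open>b^2\<close> and
    \<open>q * t^2\<close> is -1. So \<open>n\<close> divides the coefficient of \<open>y^2\<close>
    in the form that is to be divided by \<open>n\<close>.\<close>
  have "q * (t^2 * b^2 + h) = n * (b^2 * k + 6)"
  proof -
    have "q * (t^2 * b^2 + h) = b^2 * (q * t^2 + 1) + (q * h - b^2)"
      by (simp add: algebra_simps)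
    also have "\<dots> = n * (b^2 * k + 6)"
      using h unfolding k by (simp add: algebra_simps flip: h)
    finally show ?thesis .
  qed
  then have "n dvd t^2 * b^2 + h"
    using \<open>coprime q n\<close> by (metis coprime_commute coprime_dvd_mult_right_iff dvd_triv_left)
  then obtain l where l: "t^2 * b^2 + h = n * l" ..
  have "n * k > 0"
    using \<open>q > 0\<close> by (simp flip: k add: add_nonneg_pos)
  then have "k > 0"
    using assms(1) by (simp add: zero_less_mult_iff)
  have "n * (q * l - b^2 * k) = n * 6"
  proof -
    have "n * (q * l - b^2 * k) = q * (n * l) - b^2 * (n * k)" by (simp add: algebra_simps)
    also have "\<dots> = q * h - b^2"
      unfolding k[symmetric] l[symmetric] by (simp add: algebra_simps)
    also have "\<dots> = n * 6" by (simp flip: h)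
    finally show ?thesis .
  qed
  then have ql: "q * l - b^2 * k = 6"
    using assms(1) by simp
  \<comment> \<open>These are the coefficients of \<open>(t * (q * x + b * y) + n * z)^2 + q * x^2 +
    2 * b * x * y + h * y^2\<close> divided by \<open>n\<close>. The determinant factors as
    \<open>(n * k - q * t^2) * (q * l - b^2 * k)\<close>, which is 1 times 6.\<close>
  have "\<exists>x y z. (q * k) * x^2 + l * y^2 + n * z^2 + 2 * (t * b) * y * z
      + 2 * (t * q) * x * z + 2 * (b * k) * x * y = 1"
  proof (rule ternary_form_det_6)
    show "q * k > 0" using \<open>q > 0\<close> \<open>k > 0\<close> by simp
    have "q * k * l - (b * k)^2 = k * (q * l - b^2 * k)"
      by (simp add: power2_eq_square algebra_simps)
    then show "q * k * l - (b * k)^2 > 0"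
      using ql \<open>k > 0\<close> by simp
    have "q * k * l * n + 2 * (t * b) * (t * q) * (b * k) - q * k * (t * b)^2 - l * (t * q)^2
          - n * (b * k)^2 = (n * k - q * t^2) * (q * l - b^2 * k)"
      by (simp add: power2_eq_square algebra_simps)
    then show "q * k * l * n + 2 * (t * b) * (t * q) * (b * k) - q * k * (t * b)^2 - l * (t * q)^2
          - n * (b * k)^2 = 6"
      using ql by (simp flip: k)
    show "odd (q * k) \<or> odd l \<or> odd n" using assms(2) by simp
  qed
  then obtain x y z where xyz: "(q * k) * x^2 + l * y^2 + n * z^2 + 2 * (t * b) * y * z
      + 2 * (t * q) * x * z + 2 * (b * k) * x * y = 1"
    by blast
  define X R v where "X = q * x + b * y" and "R = t * X + n * z"
    and "v = q * x^2 + 2 * b * x * y + h * y^2"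
  have qv: "q * v = X^2 + 6 * n * y^2"
  proof -
    have "q * v = (q * x)^2 + 2 * q * b * x * y + (q * h) * y^2"
      unfolding v_def by (simp add: power2_eq_square algebra_simps)
    also have "\<dots> = X^2 + 6 * n * y^2"
      unfolding X_def h[symmetric] by (simp add: power2_eq_square algebra_simps)
    finally show ?thesis .
  qed
  have nRv: "n = R^2 + v"
  proof -
    have "n * 1 = q * (n * k) * x^2 + (n * l) * y^2 + n^2 * z^2 + 2 * n * t * b * y * z
      + 2 * n * t * q * x * z + 2 * b * (n * k) * x * y"
      unfolding xyz[symmetric] by (simp add: power2_eq_square algebra_simps)
    also have "\<dots> = R^2 + v"
      unfolding R_def X_def v_def k[symmetric] l[symmetric]
      by (simp add: power2_eq_square algebra_simps)
    finally show ?thesis by simp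
  qed
  have "q * v \<ge> 0"
    unfolding qv using assms(1) by simp
  then have "v \<ge> 0"
    using \<open>q > 0\<close> by (simp add: zero_le_mult_iff)
  show ?thesis
  proof (cases "v = 0")
    case True
    then show ?thesis
      using nRv by (intro exI[of _ R] exI[of _ 0]) simp
  next
    case False
    with \<open>v \<ge> 0\<close> have "v > 0" by simp
    define s where "s = squarefree_part v"
    define m where "m = square_part v"
    have v: "v = s * m^2"
      unfolding s_def m_def by (rule squarefree_decompose)
    have "m \<noteq> 0" using v \<open>v > 0\<close> by auto
    have "squarefree s"
      unfolding s_def by (rule squarefree_squarefree_part)
    \<comment> \<open>The primes dividing \<open>s\<close> are those of odd multiplicity in
      \<open>v\<close>. Both cases below combine \<open>n = R^2 + v\<close> with
      \<open>q * v = X^2 + 6 * n * y^2\<close>.\<close>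
    have "\<exists>r. p dvd r^2 + 6" if p: "prime p" "p dvd s" for p
    proof (cases "p dvd 6")
      case True
      then show ?thesis by (intro exI[of _ 0]) simp
    next
      case False
      obtain s1 where s1: "s = p * s1" using p(2) ..
      have "\<not> p dvd s1"
        using \<open>squarefree s\<close> p(1) unfolding s1
        by (metis dvd_refl mult_dvd_mono not_prime_unit power2_eq_square squarefreeD)
      have copr: "coprime y p" if "\<not> p dvd y" for y
        using that p(1) by (simp add: coprime_commute prime_imp_coprime)
      show ?thesis
      proof (cases "p dvd n")
        case True
        \<comment> \<open>Here \<open>p\<close> divides \<open>R\<close> and \<open>X\<close>.
          Cancelling \<open>p\<close> in both equations gives \<open>q = 6 * y^2\<close> modulo
          \<open>p\<close>; as \<open>-q\<close> is a square modulo \<open>p\<close>, so is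
          \<open>-6 * y^2\<close>.\<close>
        then obtain n1 where n1: "n = p * n1" ..
        have "\<not> p dvd n1"
          using \<open>squarefree n\<close> p(1) unfolding n1
          by (metis dvd_refl mult_dvd_mono not_prime_unit power2_eq_square squarefreeD)
        have "R^2 = p * (n1 - s1 * m^2)"
          using nRv v n1 s1 by (simp add: algebra_simps)
        then have "p dvd R^2" by simp
        then obtain R1 where R1: "R = p * R1"
          using p(1) prime_dvd_power by blast
        have "p * (p * R1^2) = p * (n1 - s1 * m^2)"
          using \<open>R^2 = _\<close> unfolding R1 by (simp only: power2_eq_square mult_ac)
        then have n1': "n1 = p * R1^2 + s1 * m^2"
          using p(1) by simp
        have "X^2 = p * (q * s1 * m^2 - 6 * n1 * y^2)"
          using qv v n1 s1 by (simp add: algebra_simps)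
        then have "p dvd X^2" by simp
        then obtain X1 where X1: "X = p * X1"
          using p(1) prime_dvd_power by blast
        have "p * (p * X1^2) = p * (q * s1 * m^2 - 6 * n1 * y^2)"
          using \<open>X^2 = _\<close> unfolding X1 by (simp only: power2_eq_square mult_ac)
        then have "p * X1^2 = q * s1 * m^2 - 6 * n1 * y^2"
          using p(1) by simp
        then have "n1 * (q - 6 * y^2) = p * (X1^2 + q * R1^2)"
          unfolding n1' by (simp add: algebra_simps)
        then have "p dvd n1 * (q - 6 * y^2)" by simp
        then have *: "p dvd q - 6 * y^2"
          using p(1) \<open>\<not> p dvd n1\<close> by (simp add: prime_dvd_mult_iff)
        have "\<not> p dvd y"
        proof
          assume "p dvd y"
          then have "p dvd 6 * y^2" by (simp add: power2_eq_square)
          then have "p dvd q" using * dvd_diffD by (metis diff_add_cancel dvd_add)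
          then have "p = q" using p(1) q(1) by (simp add: primes_dvd_imp_eq)
          then show False using True q by simp
        qed
        obtain r where "p dvd r^2 + q" using res[OF p(1) True] ..
        then have "p dvd (r^2 + q) - (q - 6 * y^2)" using * by (rule dvd_diff)
        then have "p dvd r^2 + 6 * y^2" by simp
        then show ?thesis
          using copr[OF \<open>\<not> p dvd y\<close>] square_mod_divide by blast
      next
        case False
        \<comment> \<open>Here \<open>-6 * n\<close> is a square modulo \<open>p\<close>, and
          \<open>n\<close> is \<open>R^2\<close> modulo \<open>p\<close> with \<open>R\<close> prime
          to \<open>p\<close>; so -6 is a square.\<close>
        have "\<exists>r. p dvd r^2 + 6 * n"
        proof (cases "p = q")
          case True
          then show ?thesis using q(5) by blast
        next
          case False
          then have "\<not> p dvd q * s1"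
            using \<open>\<not> p dvd s1\<close> p(1) q(1) by (metis prime_dvd_multD primes_dvd_imp_eq)
          moreover have "X^2 + 6 * n * y^2 = p * (q * s1) * m^2"
            using qv v s1 by (simp add: algebra_simps)
          ultimately show ?thesis
            using square_mod_of_odd_multiplicity[OF p(1)] \<open>m \<noteq> 0\<close> by blast
        qed
        then obtain r where r: "p dvd r^2 + 6 * n" ..
        have "p dvd v" using v s1 by simp
        have "\<not> p dvd R"
        proof
          assume "p dvd R"
          then have "p dvd R^2 + v" using \<open>p dvd v\<close> by (simp add: power2_eq_square)
          then show False using False nRv by simp
        qed
        have "p dvd (r^2 + 6 * n) - 6 * v"
          using r \<open>p dvd v\<close> by (intro dvd_diff) auto
        then have "p dvd r^2 + 6 * R^2"
          using nRv by (simp add: algebra_simps)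
        then show ?thesis
          using copr[OF \<open>\<not> p dvd R\<close>] square_mod_divide by blast
      qed
    qed
    with form_1_6_or_2_3[OF \<open>v > 0\<close>] obtain \<alpha> \<beta> where
      "v = \<alpha>^2 + 6 * \<beta>^2 \<or> v = 2 * \<alpha>^2 + 3 * \<beta>^2"
      unfolding s_def by blast
    \<comment> \<open>If \<open>n\<close> is 1 modulo 3, this contradicts 3-adic anisotropy; if
      \<open>n\<close> is 2, it would make \<open>X^2\<close> congruent to 2.\<close>
    moreover have False if v2: "v = \<alpha>^2 + 6 * \<beta>^2"
    proof (cases "n mod 3 = 1")
      case True
      then show False
        using anisotropic_at_3[OF q(3) True, of \<alpha> \<beta> X y] qv v2 \<open>v > 0\<close> by simp
    next
      case False
      then have "n mod 3 = 2" using assms(4) by presburger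
      then have "v mod 3 \<noteq> 0"
        using nRv square_mod_3[of R] by (auto split: if_splits; presburger)
      then have "\<alpha>^2 mod 3 = 1"
        using v2 square_mod_3[of \<alpha>] by (auto split: if_splits; presburger)
      have "(q * \<alpha>^2) mod 3 = 2"
        using \<open>\<alpha>^2 mod 3 = 1\<close> q(3) by (simp add: mod_mult_eq[of q 3, symmetric])
      moreover have "X^2 = q * \<alpha>^2 + 3 * (2 * q * \<beta>^2 - 2 * n * y^2)"
        using qv v2 by (simp add: algebra_simps)
      ultimately have "X^2 mod 3 = 2"
        by (metis mod_mult_self2)
      then show False using square_mod_3[of X] by (auto split: if_splits)
    qed
    ultimately show ?thesis
      using nRv by (metis add.assoc)
  qed
qed

section \<open>Primes with prescribed real characters\<close>

text \<open>Abel summation: the differences of \<open>f\<close> telescope to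
  \<open>f m - f k\<close>, and the boundary term supplies the missing
  \<open>C * f k\<close>.\<close>

lemma summation_by_parts_bound:
  fixes f g :: "nat \<Rightarrow> real"
  assumes "m \<le> k"
    and antimono: "\<And>n. m \<le> n \<Longrightarrow> f (Suc n) \<le> f n" and nonneg: "\<And>n. m \<le> n \<Longrightarrow> 0 \<le> f n"
    and bound: "\<And>n. \<bar>\<Sum>i\<in>{m..<n}. g i\<bar> \<le> C"
  shows "\<bar>\<Sum>n\<in>{m..<k}. g n * f n\<bar> \<le> C * f m"
proof -
  define G where "G n = (\<Sum>i\<in>{m..<n}. g i)" for n
  have "(\<Sum>n\<in>{m..<k}. g n * f n) = G k * f k + (\<Sum>n\<in>{m..<k}. G (Suc n) * (f n - f (Suc n)))"
    using assms(1) by (induction k rule: dec_induct) (simp_all add: G_def algebra_simps)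
  moreover have "\<bar>G k * f k\<bar> \<le> C * f k"
    using bound[of k] nonneg[OF assms(1)] unfolding G_def by (simp add: abs_mult mult_right_mono)
  moreover have "\<bar>\<Sum>n\<in>{m..<k}. G (Suc n) * (f n - f (Suc n))\<bar> \<le> (\<Sum>n\<in>{m..<k}. C * (f n - f (Suc n)))"
  proof (rule order.trans[OF sum_abs sum_mono])
    fix n assume "n \<in> {m..<k}"
    then show "\<bar>G (Suc n) * (f n - f (Suc n))\<bar> \<le> C * (f n - f (Suc n))"
      using bound[of "Suc n"] antimono[of n] unfolding G_def by (simp add: abs_mult mult_right_mono)
  qed
  moreover have "(\<Sum>n\<in>{m..<k}. C * (f n - f (Suc n))) = C * (f m - f k)"
    using sum_Suc_diff'[OF assms(1), of "\<lambda>n. - f n"] by (simp flip: sum_distrib_left)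
  ultimately show ?thesis by (simp add: algebra_simps)
qed

lemma sum_divisors_swap:
  fixes g :: "nat \<Rightarrow> nat \<Rightarrow> 'a::comm_monoid_add"
  shows "(\<Sum>n\<in>{1..x}. \<Sum>d | d dvd n. g d n) = (\<Sum>d\<in>{1..x}. \<Sum>k\<in>{1..x div d}. g d (d * k))"
proof -
  have dvd_bounds: "0 < d \<and> d \<le> x" if "d dvd n" "0 < n" "n \<le> x" for d n :: nat
    using that by (meson dvd_imp_le dvd_pos_nat order.trans)
  have "(\<Sum>n\<in>{1..x}. \<Sum>d | d dvd n. g d n) = (\<Sum>(n, d)\<in>(SIGMA n:{1..x}. {d. d dvd n}). g d n)"
    by (intro sum.Sigma) (auto intro: finite_divisors_nat)
  also have "\<dots> = (\<Sum>(d, k)\<in>(SIGMA d:{1..x}. {1..x div d}). g d (d * k))"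
    by (rule sum.reindex_bij_witness[of _ "\<lambda>(d, k). (d * k, d)" "\<lambda>(n, d). (d, n div d)"])
       (auto simp: less_eq_div_iff_mult_less_eq div_le_mono Suc_le_eq mult.commute
          div_greater_zero_iff dvd_imp_le dest: dvd_bounds)
  also have "\<dots> = (\<Sum>d\<in>{1..x}. \<Sum>k\<in>{1..x div d}. g d (d * k))"
    by (intro sum.Sigma[symmetric]) auto
  finally show ?thesis .
qed

section \<open>Chebyshev and Mertens estimates for the von Mangoldt function\<close>

lemma ln_fact_eq_sum_mangoldt:
  "ln (fact x) = (\<Sum>d\<in>{1..x}. mangoldt d * real (x div d))"
proof -
  have "ln (fact x) = (\<Sum>n\<in>{1..x}. ln (real n))"
    unfolding fact_prod of_nat_prod by (subst ln_prod) auto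
  also have "\<dots> = (\<Sum>n\<in>{1..x}. \<Sum>d | d dvd n. mangoldt d)"
    by (intro sum.cong refl) (subst mangoldt_sum, auto)
  also have "\<dots> = (\<Sum>d\<in>{1..x}. \<Sum>k\<in>{1..x div d}. mangoldt d)"
    by (rule sum_divisors_swap)
  finally show ?thesis by (simp add: mult.commute)
qed

text \<open>Chebyshev's argument: in the expansion of the logarithm of the central binomial
  coefficient, the weights \<open>2 * n div d - 2 * (n div d)\<close> are nonnegative, and at least
  1 for \<open>d\<close> between \<open>n\<close> and \<open>2 * n\<close>.\<close>

lemma sum_mangoldt_half_interval:
  "(\<Sum>d\<in>{n<..2 * n}. mangoldt d) \<le> 2 * real n * ln 2"
proof -
  have "(\<Sum>d\<in>{n<..2 * n}. mangoldt d :: real)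
      \<le> (\<Sum>d\<in>{1..2 * n}. mangoldt d * (real (2 * n div d) - 2 * real (n div d)))"
  proof -
    have "2 * (n div d) \<le> 2 * n div d" for d
      by (cases "d = 0") (simp_all add: less_eq_div_iff_mult_less_eq)
    then have *: "real (2 * n div d) - 2 * real (n div d) \<ge> 0" for d
      by (metis diff_ge_0_iff_ge of_nat_le_iff of_nat_mult of_nat_numeral)
    have "(\<Sum>d\<in>{n<..2 * n}. mangoldt d :: real)
        \<le> (\<Sum>d\<in>{n<..2 * n}. mangoldt d * (real (2 * n div d) - 2 * real (n div d)))"
    proof (rule sum_mono)
      fix d assume d: "d \<in> {n<..2 * n}"
      then have "2 * n div d \<ge> 1" by (simp add: Suc_le_eq div_greater_zero_iff)
      moreover have "n div d = 0" using d by simp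
      ultimately have "real (2 * n div d) - 2 * real (n div d) \<ge> 1" by simp
      then show "mangoldt d \<le> mangoldt d * (real (2 * n div d) - 2 * real (n div d))"
        using mangoldt_nonneg[of d] by (simp add: mult_le_cancel_left1)
    qed
    also have "\<dots> \<le> (\<Sum>d\<in>{1..2 * n}. mangoldt d * (real (2 * n div d) - 2 * real (n div d)))"
      using * by (intro sum_mono2) (auto intro!: mult_nonneg_nonneg mangoldt_nonneg)
    finally show ?thesis .
  qed
  also have "\<dots> = ln (fact (2 * n)) - 2 * (\<Sum>d\<in>{1..2 * n}. mangoldt d * real (n div d))"
    unfolding ln_fact_eq_sum_mangoldt
    by (simp add: right_diff_distrib sum_subtractf sum_distrib_left algebra_simps)
  also have "(\<Sum>d\<in>{1..2 * n}. mangoldt d * real (n div d)) = ln (fact n)"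
    unfolding ln_fact_eq_sum_mangoldt by (intro sum.mono_neutral_right) auto
  also have "ln (fact (2 * n)) - 2 * ln (fact n) = ln (real (2 * n choose n))"
  proof -
    have "real (2 * n choose n) = fact (2 * n) / (fact n * fact n)"
      by (subst binomial_fact) (auto simp: mult_2)
    then show ?thesis by (simp add: ln_div ln_mult)
  qed
  also have "\<dots> \<le> ln (2 ^ (2 * n))"
  proof (subst ln_le_cancel_iff)
    have "2 * n choose n \<le> 2 ^ (2 * n)"
      using binomial_le_pow2[of "2 * n" n] by simp
    then show "real (2 * n choose n) \<le> 2 ^ (2 * n)"
      by (metis of_nat_le_iff of_nat_numeral of_nat_power)
  qed auto
  also have "\<dots> = 2 * real n * ln 2"
    by (simp add: ln_realpow)
  finally show ?thesis .
qed

text \<open>Repeated halving. With \<open>n = x div 2\<close> the bound is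
  \<open>4 * n + 2 * n * ln 2\<close>, plus at most \<open>x / 2\<close> for the term at
  \<open>x\<close>, which is left over when \<open>x\<close> is odd; this stays below
  \<open>4 * x\<close>.\<close>

lemma sum_mangoldt_le: "(\<Sum>d\<in>{1..x}. mangoldt d) \<le> 4 * real x"
proof (induction x rule: less_induct)
  case (less x)
  show ?case
  proof (cases "x \<le> 1")
    case True
    then have "x = 0 \<or> x = 1" by auto
    then show ?thesis by auto
  next
    case False
    define n where "n = x div 2"
    have n: "n < x" "x \<le> 2 * n + 1" "2 * n \<le> x" "n \<ge> 1" using False by (auto simp: n_def)
    have ln_x: "ln (real x) \<le> real x / 2"
    proof -
      have "ln (real x) = ln 2 + ln (real x / 2)"
        using False by (simp add: ln_div)
      also have "\<dots> \<le> 1 + (real x / 2 - 1)"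
        using ln_le_minus_one[of 2] ln_le_minus_one[of "real x / 2"] False by (intro add_mono) auto
      finally show ?thesis by simp
    qed
    have "{1..x} \<subseteq> {1..n} \<union> {n<..2 * n} \<union> {x}"
      using n by auto
    then have "(\<Sum>d\<in>{1..x}. mangoldt d :: real) \<le> (\<Sum>d\<in>{1..n} \<union> {n<..2 * n} \<union> {x}. mangoldt d)"
      by (intro sum_mono2) (auto intro: mangoldt_nonneg)
    also have "\<dots> \<le> (\<Sum>d\<in>{1..n} \<union> {n<..2 * n}. mangoldt d) + (\<Sum>d\<in>{x}. mangoldt d)"
      by (subst sum.union_inter[symmetric]) (auto intro!: sum_nonneg mangoldt_nonneg)
    also have "(\<Sum>d\<in>{1..n} \<union> {n<..2 * n}. mangoldt d :: real)
        = (\<Sum>d\<in>{1..n}. mangoldt d) + (\<Sum>d\<in>{n<..2 * n}. mangoldt d)"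
      by (intro sum.union_disjoint) auto
    also have "(\<Sum>d\<in>{x}. mangoldt d) \<le> real x / 2"
      using mangoldt_le[of x] ln_x n by auto
    finally have "(\<Sum>d\<in>{1..x}. mangoldt d) \<le> 4 * real n + 2 * real n * ln 2 + real x / 2"
      using less.IH[OF n(1)] sum_mangoldt_half_interval[of n] by linarith
    moreover have "2 * real n * ln 2 \<le> 2 * real n * 1"
      using ln_le_minus_one[of 2] by (intro mult_left_mono) auto
    ultimately have "(\<Sum>d\<in>{1..x}. mangoldt d) \<le> 6 * real n + real x / 2"
      by simp
    then show ?thesis using n by linarith
  qed
qed

text \<open>Compare \<open>ln (fact x)\<close> with its lower Stirling bound, and enlarge each
  \<open>x div d\<close> to \<open>x / d\<close>.\<close>

lemma sum_mangoldt_over_ge: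
  assumes "x > 0"
  shows "(\<Sum>d\<in>{1..x}. mangoldt d / real d) \<ge> ln (real x) - 1"
proof -
  have "real x * ln (real x) - real x \<le> ln (fact x)"
    using assms
  proof (induction x rule: nat_induct_non_zero)
    case (Suc x)
    have "real x * (ln (real (Suc x)) - ln (real x)) = real x * ln (1 + 1 / real x)"
    proof -
      have "1 + 1 / real x = real (Suc x) / real x" using Suc.hyps by (simp add: field_simps)
      then show ?thesis using Suc.hyps by (simp add: ln_div)
    qed
    also have "\<dots> \<le> real x * (1 / real x)"
      by (intro mult_left_mono ln_add_one_self_le_self) auto
    finally have "real x * ln (real (Suc x)) \<le> real x * ln (real x) + 1"
      using Suc.hyps by (simp add: algebra_simps)
    moreover have "ln (fact (Suc x)) = ln (real (Suc x)) + ln (fact x)"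
      unfolding fact_Suc by (simp add: ln_mult)
    ultimately show ?case
      using Suc.IH by (simp add: algebra_simps)
  qed simp
  also have "\<dots> \<le> (\<Sum>d\<in>{1..x}. mangoldt d * (real x / real d))"
    unfolding ln_fact_eq_sum_mangoldt
    by (intro sum_mono mult_left_mono mangoldt_nonneg) (simp add: of_nat_div_le_of_nat)
  also have "\<dots> = real x * (\<Sum>d\<in>{1..x}. mangoldt d / real d)"
    by (simp add: sum_distrib_left algebra_simps)
  finally have "real x * (ln (real x) - 1) \<le> real x * (\<Sum>d\<in>{1..x}. mangoldt d / real d)"
    by (simp add: algebra_simps)
  then show ?thesis using assms by simp
qed

text \<open>Each term is at most a difference of consecutive values of
  \<open>(ln y + 2) / y\<close>; the 2 absorbs
  \<open>(y + 1) * ln (1 + 1 / y) \<le> 2\<close>.\<close>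

lemma sum_ln_over_telescoping_le:
  assumes "x \<ge> 1"
  shows "(\<Sum>n\<in>{2..x}. ln (real n) / (real n * (real n - 1))) \<le> 2 - (ln (real x) + 2) / real x"
  using assms
proof (induction x rule: nat_induct_at_least)
  case (Suc x)
  define y where "y = real x"
  have y: "y \<ge> 1" using Suc.hyps by (simp add: y_def)
  have "(y + 1) * (ln (y + 1) - ln y) = (y + 1) * ln (1 + 1 / y)"
  proof -
    have "1 + 1 / y = (y + 1) / y" using y by (simp add: field_simps)
    then show ?thesis using y by (simp add: ln_div)
  qed
  also have "\<dots> \<le> (y + 1) * (1 / y)"
    using y by (intro mult_left_mono ln_add_one_self_le_self) auto
  also have "\<dots> \<le> 2" using y by (simp add: field_simps)
  finally have "ln (y + 1) \<le> (ln y + 2) * (y + 1) - (ln (y + 1) + 2) * y"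
    by (simp add: algebra_simps)
  then have "ln (y + 1) / ((y + 1) * y) \<le> ((ln y + 2) * (y + 1) - (ln (y + 1) + 2) * y) / ((y + 1) * y)"
    using y by (intro divide_right_mono) auto
  also have "\<dots> = (ln y + 2) / y - (ln (y + 1) + 2) / (y + 1)"
    using y by (simp add: diff_frac_eq)
  finally have "ln (y + 1) / ((y + 1) * y) \<le> (ln y + 2) / y - (ln (y + 1) + 2) / (y + 1)" .
  moreover have "{2..Suc x} = insert (Suc x) {2..x}" using Suc.hyps by auto
  ultimately show ?case
    using Suc.IH by (simp add: y_def algebra_simps)
qed simp

text \<open>Summing the geometric series over exponents \<open>k \<ge> 2\<close> leaves
  \<open>ln p / (p * (p - 1))\<close> for each prime \<open>p\<close>, and the sum over primes is
  enlarged to all integers.\<close>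

lemma sum_mangoldt_over_prime_powers_le:
  "(\<Sum>d | d \<in> {1..x} \<and> \<not> prime d. mangoldt d / real d) \<le> 2"
proof (cases "x = 0")
  case False
  define A where "A = {d \<in> {1..x}. \<not> prime d \<and> primepow d}"
  define Q where "Q = {p \<in> {2..x}. prime p}"
  have "(\<Sum>d | d \<in> {1..x} \<and> \<not> prime d. mangoldt d / real d) = (\<Sum>d\<in>A. mangoldt d / real d)"
    unfolding A_def by (rule sum.mono_neutral_right) (auto simp: mangoldt_def)
  also have "A \<subseteq> (\<lambda>(p, k). p ^ k) ` (Q \<times> {2..x})"
  proof
    fix d assume d: "d \<in> A"
    then obtain p k where pk: "prime p" "k > 0" "d = p ^ k"
      by (auto simp: A_def primepow_def)
    have "k \<noteq> 1" using pk d by (auto simp: A_def)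
    moreover have "k < p ^ k" using prime_gt_1_nat[OF pk(1)] by (simp add: power_gt_expt)
    moreover have "p \<le> p ^ k" using pk self_le_power[of p k] prime_gt_0_nat[of p] by simp
    ultimately have "(p, k) \<in> Q \<times> {2..x}"
      using pk d prime_ge_2_nat[OF pk(1)] by (auto simp: A_def Q_def)
    then show "d \<in> (\<lambda>(p, k). p ^ k) ` (Q \<times> {2..x})"
      using pk(3) by force
  qed
  then have "(\<Sum>d\<in>A. mangoldt d / real d) \<le> (\<Sum>d\<in>(\<lambda>(p, k). p ^ k) ` (Q \<times> {2..x}). mangoldt d / real d)"
    by (intro sum_mono2) (auto simp: Q_def intro: mangoldt_nonneg)
  also have "\<dots> = (\<Sum>(p, k)\<in>Q \<times> {2..x}. mangoldt (p ^ k) / real (p ^ k))"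
    by (subst sum.reindex) (auto simp: inj_on_def Q_def prime_power_inj'' case_prod_unfold)
  also have "\<dots> = (\<Sum>p\<in>Q. \<Sum>k\<in>{2..x}. mangoldt (p ^ k) / real (p ^ k))"
    by (rule sum.cartesian_product[symmetric])
  also have "\<dots> \<le> (\<Sum>p\<in>Q. ln (real p) / (real p * (real p - 1)))"
  proof (rule sum_mono)
    fix p assume p: "p \<in> Q"
    then have "p \<ge> 2" by (simp add: Q_def)
    have "(\<Sum>k\<in>{2..x}. mangoldt (p ^ k) / real (p ^ k)) = ln (real p) * (\<Sum>k\<in>{2..x}. (1 / real p) ^ k)"
      using p unfolding sum_distrib_left
      by (intro sum.cong) (auto simp: Q_def power_one_over divide_simps)
    also have "(\<Sum>k\<in>{2..x}. (1 / real p) ^ k) \<le> 1 / (real p * (real p - 1))"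
    proof (cases "x \<ge> 2")
      case True
      then have "(\<Sum>k\<in>{2..x}. (1 / real p) ^ k) = ((1 / real p) ^ 2 - (1 / real p) ^ Suc x) / (1 - 1 / real p)"
        using \<open>p \<ge> 2\<close> by (subst sum_gp) auto
      also have "\<dots> \<le> (1 / real p) ^ 2 / (1 - 1 / real p)"
        using \<open>p \<ge> 2\<close> by (intro divide_right_mono) auto
      also have "\<dots> = 1 / (real p * (real p - 1))"
        using \<open>p \<ge> 2\<close> by (simp add: field_simps power2_eq_square)
      finally show ?thesis .
    qed (use \<open>p \<ge> 2\<close> in auto)
    finally show "(\<Sum>k\<in>{2..x}. mangoldt (p ^ k) / real (p ^ k)) \<le> ln (real p) / (real p * (real p - 1))"
      using \<open>p \<ge> 2\<close> by (simp add: mult_left_mono)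
  qed
  also have "\<dots> \<le> (\<Sum>p\<in>{2..x}. ln (real p) / (real p * (real p - 1)))"
    unfolding Q_def by (intro sum_mono2) auto
  also have "\<dots> \<le> 2 - (ln (real x) + 2) / real x"
    using False by (intro sum_ln_over_telescoping_le) auto
  also have "\<dots> \<le> 2" using False by simp
  finally show ?thesis .
qed simp

lemma sum_divisors_prime_power_mult:
  fixes f :: "nat \<Rightarrow> 'a::comm_semiring_1"
  assumes f: "\<And>m n. f (m * n) = f m * f n" "f 1 = 1"
    and "prime p" "\<not> p dvd m" "m > 0"
  shows "(\<Sum>d | d dvd p ^ k * m. f d) = (\<Sum>i\<le>k. f p ^ i) * (\<Sum>d | d dvd m. f d)"
proof -
  have pow: "f (p ^ i) = f p ^ i" for i
    by (induction i) (use f in simp_all)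
  have "inj_on (\<lambda>(i, d). p ^ i * d) ({..k} \<times> {d. d dvd m})"
  proof (intro inj_onI, clarify)
    fix i d j e assume "d dvd m" "e dvd m" and eq: "p ^ i * d = p ^ j * e"
    have "multiplicity p (p ^ i' * d') = i'" if "d' dvd m" for i' d'
    proof -
      have "\<not> p dvd d'" "d' \<noteq> 0" using that assms(4,5) by (auto intro: dvd_trans)
      then show ?thesis
        using assms(3) by (simp add: prime_elem_multiplicity_mult_distrib not_dvd_imp_multiplicity_0)
    qed
    from this[OF \<open>d dvd m\<close>, of i] this[OF \<open>e dvd m\<close>, of j] have "i = j" using eq by simp
    then show "i = j \<and> d = e" using eq assms(3) by simp
  qed
  moreover have "(\<lambda>(i, d). p ^ i * d) ` ({..k} \<times> {d. d dvd m}) = {d. d dvd p ^ k * m}"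
  proof (intro equalityI subsetI)
    fix d assume "d \<in> {d. d dvd p ^ k * m}"
    then obtain x y where xy: "d = x * y" "x dvd p ^ k" "y dvd m"
      using division_decomp by blast
    then obtain i where "i \<le> k" "x = p ^ i"
      using divides_primepow_nat[OF assms(3)] by blast
    then show "d \<in> (\<lambda>(i, d). p ^ i * d) ` ({..k} \<times> {d. d dvd m})"
      using xy by force
  qed (auto intro!: mult_dvd_mono le_imp_power_dvd)
  ultimately have "(\<Sum>d | d dvd p ^ k * m. f d) = (\<Sum>(i, d)\<in>{..k} \<times> {d. d dvd m}. f (p ^ i * d))"
    by (simp add: sum.reindex case_prod_unfold flip: \<open>_ = {d. d dvd p ^ k * m}\<close>)
  also have "\<dots> = (\<Sum>i\<le>k. f p ^ i) * (\<Sum>d | d dvd m. f d)"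
    by (simp add: f pow sum_product sum.cartesian_product)
  finally show ?thesis .
qed

section \<open>Real characters: divisor sums and the L-series at 1\<close>

lemma geometric_sum_sign:
  fixes v :: real
  assumes "v \<in> {-1, 0, 1}"
  shows "(\<Sum>i\<le>k. v ^ i) \<ge> (if even k then 1 else 0)"
proof -
  have "(\<Sum>i\<le>k. (-1::real) ^ i) = (if even k then 1 else 0)"
    by (induction k) auto
  moreover have "(\<Sum>i\<le>k. (0::real) ^ i) = 1"
    by (induction k) auto
  ultimately show ?thesis using assms by auto
qed

lemma nat_prime_power_decomposition:
  assumes "n > (1::nat)"
  obtains p k m where "prime p" "n = p ^ k * m" "\<not> p dvd m" "0 < m" "m < n"
proof -
  obtain p where p: "prime p" "p dvd n"
    using prime_factor_nat[of n] assms by auto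
  obtain m where m: "n = p ^ multiplicity p n * m" "\<not> p dvd m"
  proof (rule multiplicity_decompose')
    show "n \<noteq> 0" "\<not> is_unit p" using assms p by auto
  qed blast
  have "m > 0" using m(1) assms by (cases m) auto
  moreover have "m < n"
    using p m \<open>m > 0\<close> by (metis dvd_triv_right linorder_neqE_nat dvd_imp_le leD assms not_one_less_zero less_imp_not_eq gr0I)
  ultimately show ?thesis using that p m by blast
qed

text \<open>Real Dirichlet characters modulo \<open>N\<close>, principal or not and not necessarily
  primitive.\<close>

locale quadratic_character =
  fixes N :: nat and \<chi> :: "nat \<Rightarrow> real"
  assumes modulus_pos: "N > 0"
    and one: "\<chi> 1 = 1"
    and mult: "\<chi> (m * n) = \<chi> m * \<chi> n"
    and periodic: "\<chi> (n + N) = \<chi> n"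
    and coprime: "coprime n N \<Longrightarrow> \<chi> n = 1 \<or> \<chi> n = -1"
    and not_coprime: "\<not> coprime n N \<Longrightarrow> \<chi> n = 0"

context quadratic_character
begin

lemma range: "\<chi> n \<in> {-1, 0, 1}"
  using coprime[of n] not_coprime[of n] by auto

lemma abs_le_1: "\<bar>\<chi> n\<bar> \<le> 1"
  using range[of n] by auto

text \<open>The divisor sum is multiplicative in \<open>n\<close>, and at a prime power it is a
  geometric sum with ratio -1, 0 or 1.\<close>

lemma sum_divisors_nonneg:
  assumes "n > 0"
  shows "(\<Sum>d | d dvd n. \<chi> d) \<ge> 0"
  using assms
proof (induction n rule: less_induct)
  case (less n)
  show ?case
  proof (cases "n = 1")
    case False
    then obtain p k m where pkm: "prime p" "n = p ^ k * m" "\<not> p dvd m" "0 < m" "m < n"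
      using nat_prime_power_decomposition less.prems by (metis less_one nat_neq_iff)
    have "(\<Sum>i\<le>k. \<chi> p ^ i) \<ge> 0"
      using geometric_sum_sign[OF range[of p], of k] by (simp split: if_splits)
    then show ?thesis
      unfolding pkm(2) using sum_divisors_prime_power_mult[OF mult one pkm(1,3,4)] less.IH pkm
      by simp
  qed (use one in simp)
qed

text \<open>Squares have even exponents, where the geometric sum is at least 1 even for ratio
  -1.\<close>

lemma sum_divisors_square_ge_1:
  assumes "j > 0"
  shows "(\<Sum>d | d dvd j ^ 2. \<chi> d) \<ge> 1"
  using assms
proof (induction j rule: less_induct)
  case (less j)
  show ?case
  proof (cases "j = 1")
    case False
    then obtain p k m where pkm: "prime p" "j = p ^ k * m" "\<not> p dvd m" "0 < m" "m < j"
      using nat_prime_power_decomposition less.prems by (metis less_one nat_neq_iff)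
    have "j ^ 2 = p ^ (2 * k) * m ^ 2" unfolding pkm(2) by (simp add: power_mult_distrib power_even_eq)
    moreover have "\<not> p dvd m ^ 2" using pkm by (simp add: prime_dvd_power_iff)
    ultimately have "(\<Sum>d | d dvd j ^ 2. \<chi> d) = (\<Sum>i\<le>2 * k. \<chi> p ^ i) * (\<Sum>d | d dvd m ^ 2. \<chi> d)"
      using sum_divisors_prime_power_mult[OF mult one pkm(1)] pkm(4) by simp
    moreover have "(\<Sum>i\<le>2 * k. \<chi> p ^ i) \<ge> 1"
      using geometric_sum_sign[OF range[of p], of "2 * k"] by simp
    ultimately show ?thesis
      using mult_mono[of 1 "\<Sum>i\<le>2 * k. \<chi> p ^ i" 1 "\<Sum>d | d dvd m ^ 2. \<chi> d"] less.IH[OF pkm(5,4)]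
      by simp
  qed (use one in simp)
qed

lemma periodic_mult: "\<chi> (n + k * N) = \<chi> n"
proof (induction k)
  case (Suc k)
  then show ?case using periodic[of "n + k * N"] by (simp add: add_ac)
qed simp

lemma mod_eq: "\<chi> (n mod N) = \<chi> n"
  using periodic_mult[of "n mod N" "n div N"] by simp

end

locale nonprincipal_quadratic_character = quadratic_character +
  assumes nonprincipal: "\<exists>c. \<chi> c = -1"
begin

text \<open>Multiplication by \<open>c\<close> permutes the residues and negates the sum over a
  period; the induction then slides the window.\<close>

lemma sum_period: "(\<Sum>n\<in>{m..<m + N}. \<chi> n) = 0"
proof (induction m)
  case 0
  obtain c where c: "\<chi> c = -1" using nonprincipal by blast
  have copr: "coprime c N" using c not_coprime[of c] by force
  have inj: "inj_on (\<lambda>n. c * n mod N) {..<N}"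
  proof (rule inj_onI)
    fix x y assume xy: "x \<in> {..<N}" "y \<in> {..<N}" "c * x mod N = c * y mod N"
    then have "[c * x = c * y] (mod N)" by (simp add: cong_def)
    then have "[x = y] (mod N)" using copr cong_mult_lcancel_nat by blast
    then show "x = y" using xy by (simp add: cong_def)
  qed
  have "(\<lambda>n. c * n mod N) ` {..<N} = {..<N}"
    using inj modulus_pos by (intro endo_inj_surj) auto
  then have "(\<Sum>n<N. \<chi> n) = (\<Sum>n<N. \<chi> (c * n mod N))"
    using inj by (metis (no_types, lifting) sum.reindex_cong)
  also have "\<dots> = - (\<Sum>n<N. \<chi> n)"
    by (simp add: mod_eq mult c sum_negf)
  finally show ?case by (simp add: atLeast0LessThan)
next
  case (Suc m)
  have "(\<Sum>n\<in>{m..<Suc (m + N)}. \<chi> n) = \<chi> m + (\<Sum>n\<in>{Suc m..<Suc (m + N)}. \<chi> n)"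
    by (rule sum.atLeast_Suc_lessThan) simp
  moreover have "(\<Sum>n\<in>{m..<Suc (m + N)}. \<chi> n) = (\<Sum>n\<in>{m..<m + N}. \<chi> n) + \<chi> (m + N)"
    by simp
  ultimately show ?case
    using Suc.IH periodic[of m] by simp
qed

lemma interval_sum_bound: "\<bar>\<Sum>n\<in>{m..<k}. \<chi> n\<bar> \<le> real N"
proof (induction "k - m" arbitrary: m rule: less_induct)
  case less
  show ?case
  proof (cases "m + N \<le> k")
    case True
    then have "(\<Sum>n\<in>{m..<k}. \<chi> n) = (\<Sum>n\<in>{m..<m + N}. \<chi> n) + (\<Sum>n\<in>{m + N..<k}. \<chi> n)"
      by (simp add: sum.atLeastLessThan_concat)
    then show ?thesis
      using less.hyps[of "m + N"] True modulus_pos sum_period[of m] by simp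
  next
    case False
    have "\<bar>\<Sum>n\<in>{m..<k}. \<chi> n\<bar> \<le> (\<Sum>n\<in>{m..<k}. 1)"
      using abs_le_1 by (intro order.trans[OF sum_abs sum_mono]) auto
    also have "\<dots> \<le> real N" using False by simp
    finally show ?thesis .
  qed
qed

lemma weighted_sum_bound:
  assumes "m \<le> Suc k" "\<And>n. m \<le> n \<Longrightarrow> f (Suc n) \<le> f n" "\<And>n. m \<le> n \<Longrightarrow> 0 \<le> f n"
  shows "\<bar>\<Sum>n\<in>{m..k}. \<chi> n * f n\<bar> \<le> real N * f m"
  using summation_by_parts_bound[of m "Suc k" f \<chi>, OF assms] interval_sum_bound
  by (simp add: atLeastLessThanSuc_atLeastAtMost)

text \<open>Abel summation makes the partial sums Cauchy. The explicit rate is recorded because both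
  the nonvanishing of \<open>L\<close> and the Mertens argument use it.\<close>

lemma L_series:
  "\<exists>L. \<forall>x. \<bar>(\<Sum>n\<in>{1..x}. \<chi> n / real n) - L\<bar> \<le> real N / real (Suc x)"
proof -
  define P where "P x = (\<Sum>n\<in>{1..x}. \<chi> n / real n)" for x
  have diff: "\<bar>P y - P x\<bar> \<le> real N / real (Suc x)" if "x \<le> y" for x y
  proof -
    have "{1..y} = {1..x} \<union> {Suc x..y}" using that by auto
    then have "P y - P x = (\<Sum>n\<in>{Suc x..y}. \<chi> n * (1 / real n))"
      by (simp add: P_def sum.union_disjoint)
    then show ?thesis
      using weighted_sum_bound[of "Suc x" y "\<lambda>n. 1 / real n"] that by (simp add: frac_le)
  qed
  have "Cauchy P"
  proof (rule CauchyI')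
    fix e :: real assume "e > 0"
    obtain M where M: "real M > real N / e" using reals_Archimedean2 by blast
    have "\<bar>P m - P n\<bar> < e" if "m \<ge> M" "n > m" for m n
    proof -
      have "real N < e * real (Suc m)"
        using M \<open>e > 0\<close> that by (simp add: field_simps) (smt (verit) mult_left_mono of_nat_le_iff)
      then have "real N / real (Suc m) < e" by (simp add: field_simps)
      then show ?thesis using diff[of m n] that by linarith
    qed
    then show "\<exists>M. \<forall>m\<ge>M. \<forall>n>m. dist (P m) (P n) < e" by (auto simp: dist_real_def)
  qed
  then obtain L where L: "P \<longlonglongrightarrow> L"
    using Cauchy_convergent_iff convergent_def by blast
  have "\<bar>P x - L\<bar> \<le> real N / real (Suc x)" for x
  proof (rule tendsto_upperbound)
    show "(\<lambda>y. \<bar>P x - P y\<bar>) \<longlonglongrightarrow> \<bar>P x - L\<bar>"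
      using L by (intro tendsto_intros)
    show "\<forall>\<^sub>F y in sequentially. \<bar>P x - P y\<bar> \<le> real N / real (Suc x)"
      using diff by (intro eventually_sequentiallyI[of x]) (metis abs_minus_commute)
  qed simp
  then show ?thesis unfolding P_def by blast
qed

text \<open>Abel summation starts at 3, since \<open>ln n / n\<close> decreases only beyond
  \<open>exp 1\<close>; the term at 1 vanishes.\<close>

lemma log_weighted_sum_bounded:
  "\<exists>K. \<forall>x. \<bar>\<Sum>n\<in>{1..x}. \<chi> n * (ln (real n) / real n)\<bar> \<le> K"
proof (intro exI allI)
  fix x
  have antimono: "ln (real (Suc n)) / real (Suc n) \<le> ln (real n) / real n" if "3 \<le> n" for n
  proof -
    have "1 + 1 / real n = real (Suc n) / real n" using that by (simp add: field_simps)
    then have "ln (real (Suc n)) - ln (real n) = ln (1 + 1 / real n)"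
      using that by (simp add: ln_div)
    also have "\<dots> \<le> 1 / real n" by (rule ln_add_one_self_le_self) simp
    finally have "real n * (ln (real (Suc n)) - ln (real n)) \<le> 1"
      using that by (simp add: field_simps)
    moreover have "ln (real n) \<ge> 1"
      using that exp_le by (subst ln_ge_iff) auto
    ultimately show ?thesis using that by (simp add: field_simps)
  qed
  define f where "f n = \<chi> n * (ln (real n) / real n)" for n
  have "\<bar>\<Sum>n\<in>{1..x}. f n\<bar> \<le> \<bar>f 2\<bar> + real N * (ln 3 / 3)"
  proof (cases "x \<ge> 3")
    case True
    then have "{1..x} = {1, 2} \<union> {3..x}" by auto
    then have "(\<Sum>n\<in>{1..x}. f n) = f 2 + (\<Sum>n\<in>{3..x}. f n)"
      by (simp add: f_def)
    moreover have "\<bar>\<Sum>n\<in>{3..x}. f n\<bar> \<le> real N * (ln (real 3) / real 3)"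
      unfolding f_def using True antimono
      by (intro weighted_sum_bound) auto
    ultimately show ?thesis by simp
  next
    case False
    then have "x = 0 \<or> x = 1 \<or> x = 2" by auto
    moreover have "{1..2} = {1, 2::nat}" by auto
    ultimately show ?thesis by (auto simp: f_def intro!: add_nonneg_nonneg)
  qed
  then show "\<bar>\<Sum>n\<in>{1..x}. \<chi> n * (ln (real n) / real n)\<bar>
      \<le> \<bar>\<chi> 2 * (ln (real 2) / real 2)\<bar> + real N * (ln 3 / 3)"
    unfolding f_def .
qed

text \<open>Monsky's argument: \<open>\<Sum>n. (\<Sum>d | d dvd n. \<chi> d) * t ^ n\<close> is unbounded as \<open>t\<close> tends to \<open>1\<close>, because
  its coefficients are nonnegative and at least \<open>1\<close> at squares. It is also the Lambert series
  \<open>\<Sum>d. \<chi> d * t ^ d / (1 - t ^ d)\<close>, which for \<open>L = 0\<close> equals \<open>- (\<Sum>d. \<chi> d * b d)\<close> below with \<open>b\<close>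
  decreasing from \<open>1\<close>, hence stays bounded. All series are truncated at \<open>M\<close>.\<close>

lemma L_nonzero:
  assumes L: "\<And>x. \<bar>(\<Sum>n\<in>{1..x}. \<chi> n / real n) - L\<bar> \<le> real N / real (Suc x)"
  shows "L \<noteq> 0"
proof
  assume "L = 0"
  \<comment> \<open>The \<open>K\<close> squares up to \<open>K^2\<close> each contribute at least
    \<open>t ^ K^2 = s\<close>, so the sum is at least \<open>K * s = N + 1/2\<close>, beyond the
    limit \<open>N\<close> of the upper bound.\<close>
  define K where "K = N + 1"
  define s where "s = (real N + 1 / 2) / (real N + 1)"
  define t where "t = root (K\<^sup>2) s"
  have s: "0 < s" "s < 1" by (simp_all add: s_def add_pos_pos)
  have "K > 0" by (simp add: K_def)
  have t: "0 < t" "t < 1" "t ^ (K\<^sup>2) = s"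
    using s \<open>K > 0\<close> by (simp_all add: t_def)
  \<comment> \<open>The first term bounds the partial sum of the L-series divided by
    \<open>1 - t\<close>, using \<open>L = 0\<close>; the second bounds the tails cut off from
    \<open>M\<close> geometric series.\<close>
  define err where "err M = real N / ((1 - t) * real (Suc M)) + real M * t ^ M / (1 - t)" for M
  have upper: "(\<Sum>n\<in>{1..M}. (\<Sum>d | d dvd n. \<chi> d) * t ^ n) \<le> real N + err M" for M
  proof -
    define a where "a d = t ^ d / (1 - t ^ d)" for d
    define b where "b d = 1 / (real d * (1 - t)) - a d" for d
    have pow_less: "t ^ d < 1" if "d > 0" for d
      using t that by (simp add: power_less_one_iff)
    have "(\<Sum>n\<in>{1..M}. (\<Sum>d | d dvd n. \<chi> d) * t ^ n)
        = (\<Sum>n\<in>{1..M}. \<Sum>d | d dvd n. \<chi> d * t ^ n)"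
      by (simp add: sum_distrib_right)
    also have "\<dots> = (\<Sum>d\<in>{1..M}. \<Sum>k\<in>{1..M div d}. \<chi> d * t ^ (d * k))"
      by (rule sum_divisors_swap)
    also have "\<dots> \<le> (\<Sum>d\<in>{1..M}. \<chi> d * a d + t ^ M / (1 - t))"
    proof (rule sum_mono)
      fix d assume d: "d \<in> {1..M}"
      define e where "e = t ^ (d * Suc (M div d)) / (1 - t ^ d)"
      have "(\<Sum>k\<in>{1..M div d}. (t ^ d) ^ k) = a d - e"
        using pow_less[of d] d unfolding a_def e_def
        by (subst sum_gp) (auto simp: power_mult power_add diff_divide_distrib)
      then have "(\<Sum>k\<in>{1..M div d}. \<chi> d * t ^ (d * k)) = \<chi> d * a d - \<chi> d * e"
        by (simp add: power_mult right_diff_distrib flip: sum_distrib_left)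
      moreover have "0 \<le> e"
        using t pow_less[of d] d by (auto simp: e_def)
      moreover have "e \<le> t ^ M / (1 - t)"
      proof -
        have "M \<le> d * Suc (M div d)"
          using dividend_less_times_div[of d M] d by simp
        then have "t ^ (d * Suc (M div d)) \<le> t ^ M"
          using t by (intro power_decreasing) auto
        moreover have "t ^ d \<le> t ^ 1"
          using t d by (intro power_decreasing) auto
        ultimately show ?thesis
          unfolding e_def using t by (intro frac_le) auto
      qed
      ultimately show "(\<Sum>k\<in>{1..M div d}. \<chi> d * t ^ (d * k)) \<le> \<chi> d * a d + t ^ M / (1 - t)"
        using range[of d] by auto
    qed
    also have "\<dots> = (\<Sum>d\<in>{1..M}. \<chi> d * a d) + real M * t ^ M / (1 - t)"
      by (simp add: sum.distrib)
    finally have "(\<Sum>n\<in>{1..M}. (\<Sum>d | d dvd n. \<chi> d) * t ^ n)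
        \<le> (\<Sum>d\<in>{1..M}. \<chi> d * a d) + real M * t ^ M / (1 - t)" .
    moreover have "(\<Sum>d\<in>{1..M}. \<chi> d * a d)
        = (\<Sum>d\<in>{1..M}. \<chi> d / real d) / (1 - t) - (\<Sum>d\<in>{1..M}. \<chi> d * b d)"
      by (simp add: b_def sum_divide_distrib right_diff_distrib sum_subtractf)
    moreover have "(\<Sum>d\<in>{1..M}. \<chi> d / real d) / (1 - t) \<le> real N / ((1 - t) * real (Suc M))"
    proof -
      have "(\<Sum>d\<in>{1..M}. \<chi> d / real d) \<le> real N / real (Suc M)"
        using L[of M] \<open>L = 0\<close> by simp
      then have "(\<Sum>d\<in>{1..M}. \<chi> d / real d) / (1 - t) \<le> real N / real (Suc M) / (1 - t)"
        using t by (intro divide_right_mono) auto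
      then show ?thesis by (simp add: mult.commute)
    qed
    moreover have "- (\<Sum>d\<in>{1..M}. \<chi> d * b d) \<le> real N * b 1"
    proof -
      define S where "S d = (\<Sum>i<d. t ^ i)" for d
      have S: "1 - t ^ d = (1 - t) * S d" for d
        unfolding S_def by (rule one_diff_power_eq)
      have S_pos: "S d > 0" if "d > 0" for d
      proof -
        have "0 < (1 - t) * S d" unfolding S[symmetric] using pow_less[OF that] by simp
        then show ?thesis using t by (simp add: zero_less_mult_iff)
      qed
      have "0 \<le> b d" if "1 \<le> d" for d
      proof -
        have "(\<Sum>i<d. t ^ d) \<le> S d"
          unfolding S_def using t by (intro sum_mono power_decreasing) auto
        then have "real d * t ^ d * (1 - t) \<le> S d * (1 - t)"
          using t by (intro mult_right_mono) auto
        then have "t ^ d * (real d * (1 - t)) \<le> 1 * (1 - t ^ d)"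
          unfolding S by (simp add: mult_ac)
        then show ?thesis
          using that t pow_less[of d] by (simp add: b_def a_def frac_le_eq divide_le_eq pos_le_divide_eq)
      qed
      moreover have "b (Suc d) \<le> b d" if "1 \<le> d" for d
      proof -
        \<comment> \<open>Monotonicity of \<open>b\<close> amounts to
          \<open>d * (d + 1) * t ^ d \<le> S d * S (d + 1)\<close>. Pairing each term of the product
          with the one from reversed indices gives exponents of sum \<open>2 * d - 1\<close>, to
          which the inequality of arithmetic and geometric means applies.\<close>
        have prod_ge: "2 * t ^ d \<le> t ^ i + t ^ j" if "i + j = 2 * d - 1" for i j
        proof (rule power2_le_imp_le)
          have "(2 * t ^ d)\<^sup>2 = 4 * t ^ (2 * d)"
            by (simp add: power_mult_distrib power_even_eq)
          also have "\<dots> \<le> 4 * t ^ (i + j)"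
            using t that by (intro mult_left_mono power_decreasing) auto
          also have "\<dots> \<le> (t ^ i + t ^ j)\<^sup>2"
            using zero_le_power2[of "t ^ i - t ^ j"] by (simp add: power2_eq_square power_add algebra_simps)
          finally show "(2 * t ^ d)\<^sup>2 \<le> (t ^ i + t ^ j)\<^sup>2" .
        qed (use t in auto)
        have rev: "(\<Sum>i<n. t ^ (n - Suc i)) = S n" for n
          unfolding S_def by (rule sum.nat_diff_reindex)
        have "2 * (S d * S (Suc d))
            = S d * S (Suc d) + (\<Sum>i<d. t ^ (d - Suc i)) * (\<Sum>j<Suc d. t ^ (Suc d - Suc j))"
          unfolding rev by simp
        also have "\<dots> = (\<Sum>i<d. \<Sum>j<Suc d. t ^ (i + j) + t ^ ((d - Suc i) + (Suc d - Suc j)))"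
          by (simp only: S_def sum_product power_add sum.distrib)
        also have "\<dots> \<ge> (\<Sum>i<d. \<Sum>j<Suc d. 2 * t ^ d)"
          using that by (intro sum_mono prod_ge) auto
        finally have *: "real d * real (Suc d) * t ^ d \<le> S d * S (Suc d)"
          by (simp add: algebra_simps)
        have pos: "S d > 0" "S (Suc d) > 0" "real d > 0" using S_pos that by auto
        have "a d - a (Suc d) = t ^ d / ((1 - t) * (S d * S (Suc d)))"
        proof -
          have "t ^ d * (1 - t ^ Suc d) - t ^ Suc d * (1 - t ^ d) = t ^ d * (1 - t)"
            by (simp add: algebra_simps)
          then have "a d - a (Suc d) = t ^ d * (1 - t) / ((1 - t ^ d) * (1 - t ^ Suc d))"
            unfolding a_def using pow_less[of d] pow_less[of "Suc d"] that by (simp add: diff_frac_eq)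
          moreover have "x * u / ((u * p) * (u * r)) = x / (u * (p * r))" if "u \<noteq> 0" for x u p r :: real
            using that by simp
          ultimately show ?thesis using t unfolding S by simp
        qed
        also have "\<dots> \<le> 1 / ((1 - t) * (real d * real (Suc d)))"
        proof -
          have "x / (u * p) \<le> 1 / (u * r)" if "r * x \<le> p" "u > 0" "p > 0" "r > 0" for x u p r :: real
            using that by (simp add: divide_simps mult.commute)
          then show ?thesis using * t pos by simp
        qed
        also have "\<dots> = 1 / (real d * (1 - t)) - 1 / (real (Suc d) * (1 - t))"
        proof -
          have "1 / (u * (y * (y + 1))) = 1 / (y * u) - 1 / ((y + 1) * u)" if "u \<noteq> 0" "y > 0" for u y :: real
            using that by (simp add: divide_simps)
          from this[of "1 - t" "real d"] show ?thesis using t pos by (simp add: add.commute)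
        qed
        finally show ?thesis by (simp add: b_def)
      qed
      ultimately have "\<bar>\<Sum>d\<in>{1..M}. \<chi> d * b d\<bar> \<le> real N * b 1"
        by (intro weighted_sum_bound) auto
      then show ?thesis by linarith
    qed
    moreover have "b 1 = 1"
      using t by (simp add: b_def a_def divide_simps)
    ultimately show ?thesis unfolding err_def by simp
  qed
  have lower: "real K * s \<le> (\<Sum>n\<in>{1..M}. (\<Sum>d | d dvd n. \<chi> d) * t ^ n)" if "M \<ge> K\<^sup>2" for M
  proof -
    have "real K * s = (\<Sum>j\<in>{1..K}. t ^ (K\<^sup>2))"
      using t by simp
    also have "\<dots> \<le> (\<Sum>j\<in>{1..K}. (\<Sum>d | d dvd j\<^sup>2. \<chi> d) * t ^ (j\<^sup>2))"
    proof (rule sum_mono)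
      fix j assume j: "j \<in> {1..K}"
      then have "t ^ (K\<^sup>2) \<le> t ^ (j\<^sup>2)"
        using t by (intro power_decreasing power_mono) auto
      also have "\<dots> \<le> (\<Sum>d | d dvd j\<^sup>2. \<chi> d) * t ^ (j\<^sup>2)"
        using sum_divisors_square_ge_1[of j] j t by (simp add: mult_le_cancel_right1)
      finally show "t ^ (K\<^sup>2) \<le> (\<Sum>d | d dvd j\<^sup>2. \<chi> d) * t ^ (j\<^sup>2)" .
    qed
    also have "\<dots> = (\<Sum>n\<in>(\<lambda>j. j\<^sup>2) ` {1..K}. (\<Sum>d | d dvd n. \<chi> d) * t ^ n)"
      by (subst sum.reindex) (auto simp: inj_on_def)
    also have "\<dots> \<le> (\<Sum>n\<in>{1..M}. (\<Sum>d | d dvd n. \<chi> d) * t ^ n)"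
    proof (rule sum_mono2)
      show "(\<lambda>j. j\<^sup>2) ` {1..K} \<subseteq> {1..M}"
        using that by (auto intro: order.trans[OF power_mono])
    qed (use t sum_divisors_nonneg in auto)
    finally show ?thesis .
  qed
  have "err \<longlonglongrightarrow> 0"
  proof -
    have "(\<lambda>M. real N / (1 - t) * (1 / real (Suc M))) \<longlonglongrightarrow> real N / (1 - t) * 0"
      by (intro tendsto_mult_left LIMSEQ_inverse_real_of_nat[unfolded inverse_eq_divide])
    moreover have "(\<lambda>M. real M * t ^ M / (1 - t)) \<longlonglongrightarrow> 0 / (1 - t)"
      using t by (intro tendsto_divide powser_times_n_limit_0) auto
    ultimately show ?thesis
      unfolding err_def using tendsto_add by fastforce
  qed
  then have "(\<lambda>M. real N + err M) \<longlonglongrightarrow> real N + 0"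
    by (intro tendsto_intros)
  moreover have "\<forall>\<^sub>F M in sequentially. real K * s \<le> real N + err M"
    using lower upper order.trans by (intro eventually_sequentiallyI[of "K\<^sup>2"]) blast
  ultimately have "real K * s \<le> real N"
    by (simp add: tendsto_lowerbound)
  moreover have "real K * s = real N + 1 / 2"
  proof -
    have "real K = real N + 1" "real N + 1 \<noteq> 0" by (simp_all add: K_def)
    then show ?thesis
      unfolding s_def by (metis nonzero_mult_div_cancel_left times_divide_eq_right)
  qed
  ultimately show False by simp
qed

text \<open>Mertens' argument: writing \<open>ln n\<close> as a divisor sum of
  \<open>mangoldt\<close> turns the bounded logarithmic sum into \<open>L\<close> times the sum in
  question plus an error. As \<open>P (x div d)\<close> differs from \<open>L\<close> by at most
  \<open>N * d / x\<close>, the error is at most \<open>4 * N\<close> by Chebyshev's bound; then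
  divide by \<open>L\<close>.\<close>

lemma sum_mangoldt_over_bounded:
  "\<exists>B. \<forall>x. \<bar>\<Sum>d\<in>{1..x}. \<chi> d * (mangoldt d / real d)\<bar> \<le> B"
proof -
  obtain L where L: "\<bar>(\<Sum>n\<in>{1..x}. \<chi> n / real n) - L\<bar> \<le> real N / real (Suc x)" for x
    using L_series by blast
  obtain K where K: "\<bar>\<Sum>n\<in>{1..x}. \<chi> n * (ln (real n) / real n)\<bar> \<le> K" for x
    using log_weighted_sum_bounded by blast
  define P where "P x = (\<Sum>n\<in>{1..x}. \<chi> n / real n)" for x
  have "\<bar>\<Sum>d\<in>{1..x}. \<chi> d * (mangoldt d / real d)\<bar> \<le> (K + 4 * real N) / \<bar>L\<bar>" for x
  proof -
    let ?M = "\<Sum>d\<in>{1..x}. \<chi> d * (mangoldt d / real d)"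
    let ?E = "\<Sum>d\<in>{1..x}. \<chi> d * (mangoldt d / real d) * (P (x div d) - L)"
    have "(\<Sum>n\<in>{1..x}. \<chi> n * (ln (real n) / real n))
        = (\<Sum>n\<in>{1..x}. \<Sum>d | d dvd n. \<chi> n * (mangoldt d / real n))"
      by (intro sum.cong refl)
         (simp add: mangoldt_sum[where 'a = real, simplified, symmetric] sum_distrib_left sum_divide_distrib)
    also have "\<dots> = (\<Sum>d\<in>{1..x}. \<Sum>k\<in>{1..x div d}. \<chi> (d * k) * (mangoldt d / real (d * k)))"
      by (rule sum_divisors_swap)
    also have "\<dots> = (\<Sum>d\<in>{1..x}. \<chi> d * (mangoldt d / real d) * P (x div d))"
      unfolding P_def sum_distrib_left by (simp add: mult mult_ac)
    also have "\<dots> = L * ?M + ?E"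
    proof -
      have "u * p = L * u + u * (p - L)" for u p
        by (simp add: right_diff_distrib)
      then show ?thesis
        unfolding sum_distrib_left sum.distrib[symmetric] by (rule sum.cong[OF refl])
    qed
    finally have "\<bar>L * ?M\<bar> \<le> K + \<bar>?E\<bar>"
      using K[of x] by linarith
    also have "\<bar>?E\<bar> \<le> (\<Sum>d\<in>{1..x}. mangoldt d * (real N / real x))"
    proof (rule order.trans[OF sum_abs sum_mono])
      fix d assume d: "d \<in> {1..x}"
      have "\<bar>\<chi> d * (mangoldt d / real d) * (P (x div d) - L)\<bar>
          \<le> 1 * (mangoldt d / real d) * (real N / real (Suc (x div d)))"
        unfolding abs_mult using L[of "x div d"] abs_le_1[of d] mangoldt_nonneg[of d]
        by (intro mult_mono) (auto simp: P_def abs_mult)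
      also have "\<dots> = mangoldt d * (real N / real (d * Suc (x div d)))"
        by (simp del: of_nat_Suc mult_Suc_right)
      also have "\<dots> \<le> mangoldt d * (real N / real x)"
      proof (intro mult_left_mono mangoldt_nonneg divide_left_mono)
        have "x \<le> d * Suc (x div d)"
          using dividend_less_times_div[of d x] d by simp
        then show "real x \<le> real (d * Suc (x div d))" by (rule of_nat_mono)
        have "0 < d * Suc (x div d)" "0 < x" using d by simp_all
        then show "0 < real (d * Suc (x div d)) * real x"
          by (simp only: of_nat_0_less_iff zero_less_mult_iff) simp
      qed simp
      finally show "\<bar>\<chi> d * (mangoldt d / real d) * (P (x div d) - L)\<bar> \<le> mangoldt d * (real N / real x)" .
    qed
    also have "\<dots> = (\<Sum>d\<in>{1..x}. mangoldt d) * (real N / real x)"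
      by (rule sum_distrib_right[symmetric])
    also have "\<dots> \<le> 4 * real x * (real N / real x)"
      by (intro mult_right_mono sum_mangoldt_le) auto
    also have "\<dots> \<le> 4 * real N" by simp
    finally show ?thesis
      using L_nonzero[OF L] by (simp add: abs_mult pos_le_divide_eq mult.commute)
  qed
  then show ?thesis by blast
qed

end

section \<open>Dirichlet's theorem for real characters\<close>

lemma quadratic_character_prod:
  assumes "N > 0" "finite J" "\<And>\<chi>. \<chi> \<in> J \<Longrightarrow> quadratic_character N \<chi>"
  shows "quadratic_character N (\<lambda>n. of_bool (coprime n N) * (\<Prod>\<chi>\<in>J. \<chi> n))"
  using assms(2,3)
proof (induction J)
  \<comment> \<open>The coprimality factor turns the empty product into the principal character
    modulo \<open>N\<close>.\<close>
  case empty
  have "coprime (n + N) N \<longleftrightarrow> coprime n N" for n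
    by (simp only: coprime_iff_gcd_eq_1 gcd_add1)
  then show ?case
    using assms(1) by unfold_locales auto
next
  case (insert \<psi> J)
  interpret \<psi>: quadratic_character N \<psi> using insert.prems by blast
  interpret J: quadratic_character N "\<lambda>n. of_bool (coprime n N) * (\<Prod>\<chi>\<in>J. \<chi> n)"
    using insert by blast
  have eq: "of_bool (coprime n N) * (\<Prod>\<chi>\<in>insert \<psi> J. \<chi> n)
      = \<psi> n * (of_bool (coprime n N) * (\<Prod>\<chi>\<in>J. \<chi> n))" for n
    using insert.hyps by simp
  show ?case
    unfolding eq
  proof
    show "\<psi> 1 * (of_bool (coprime 1 N) * (\<Prod>\<chi>\<in>J. \<chi> 1)) = 1"
      using \<psi>.one J.one by simp
    show "\<psi> (m * n) * (of_bool (coprime (m * n) N) * (\<Prod>\<chi>\<in>J. \<chi> (m * n))) =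
      \<psi> m * (of_bool (coprime m N) * (\<Prod>\<chi>\<in>J. \<chi> m)) * (\<psi> n * (of_bool (coprime n N) * (\<Prod>\<chi>\<in>J. \<chi> n)))" for m n
      by (simp only: J.mult \<psi>.mult mult_ac)
    show "\<psi> (n + N) * (of_bool (coprime (n + N) N) * (\<Prod>\<chi>\<in>J. \<chi> (n + N))) =
      \<psi> n * (of_bool (coprime n N) * (\<Prod>\<chi>\<in>J. \<chi> n))" for n
      by (simp only: J.periodic \<psi>.periodic)
    show "\<psi> n * (of_bool (coprime n N) * (\<Prod>\<chi>\<in>J. \<chi> n)) = 1 \<or>
      \<psi> n * (of_bool (coprime n N) * (\<Prod>\<chi>\<in>J. \<chi> n)) = -1" if "coprime n N" for n
      using J.coprime[OF that] \<psi>.coprime[OF that] that by auto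
    show "\<psi> n * (of_bool (coprime n N) * (\<Prod>\<chi>\<in>J. \<chi> n)) = 0" if "\<not> coprime n N" for n
      using that by simp
  qed fact
qed

text \<open>A form of Dirichlet's theorem for residue classes modulo squares: if no such prime exists,
  then \<open>\<Prod>\<chi>. 1 + \<chi> a * \<chi> d\<close> vanishes at all primes \<open>d\<close> coprime to \<open>N\<close>. Expanding the product,
  the sum of its values against \<open>mangoldt d / d\<close> is bounded, whereas the principal characters
  among the products contribute an unbounded amount and all the others a bounded one.\<close>

lemma prime_with_prescribed_characters:
  assumes "N > 0" "finite X" "\<And>\<chi>. \<chi> \<in> X \<Longrightarrow> quadratic_character N \<chi>" "coprime a N"
  shows "\<exists>q. prime q \<and> coprime q N \<and> (\<forall>\<chi>\<in>X. \<chi> q = \<chi> a)"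
proof (rule ccontr)
  assume no_prime: "\<not> ?thesis"
  define \<Lambda> :: "nat \<Rightarrow> real" where "\<Lambda> d = mangoldt d / real d" for d
  have \<Lambda>_nonneg: "\<Lambda> d \<ge> 0" for d
    by (simp add: \<Lambda>_def mangoldt_nonneg)
  define \<psi> where "\<psi> J n = of_bool (coprime n N) * (\<Prod>\<chi>\<in>J. \<chi> n)" for J :: "(nat \<Rightarrow> real) set" and n :: nat
  define W where "W n = of_bool (coprime n N) * (\<Prod>\<chi>\<in>X. 1 + \<chi> a * \<chi> n)" for n
  define E where "E x = (\<Sum>d\<in>{1..x}. of_bool (coprime d N) * \<Lambda> d)" for x
  have \<psi>: "quadratic_character N (\<psi> J)" if "J \<subseteq> X" for J
    unfolding \<psi>_def using that assms(1-3) finite_subset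
    by (intro quadratic_character_prod) blast+
  have X_range: "\<chi> n \<in> {-1, 0, 1}" if "\<chi> \<in> X" for \<chi> n
    using quadratic_character.range[OF assms(3)[OF that]] .
  have X_coprime: "\<chi> n = 1 \<or> \<chi> n = -1" if "\<chi> \<in> X" "coprime n N" for \<chi> n
    using quadratic_character.coprime[OF assms(3)[OF that(1)] that(2)] .
  have W_eq: "W n = (\<Sum>J\<in>Pow X. \<psi> J a * \<psi> J n)" for n
  proof -
    have "(\<Prod>\<chi>\<in>X. \<chi> a * \<chi> n + 1) = (\<Sum>J\<in>Pow X. (\<Prod>\<chi>\<in>J. \<chi> a * \<chi> n) * (\<Prod>\<chi>\<in>X - J. 1))"
      by (rule prod_add) fact
    then show ?thesis
      using assms(4) unfolding W_def \<psi>_def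
      by (simp add: sum_distrib_left prod.distrib mult_ac add.commute)
  qed
  have W_le: "W n \<le> 2 ^ card X" and W_nonneg: "0 \<le> W n" for n
  proof -
    have factor: "0 \<le> 1 + \<chi> a * \<chi> n \<and> 1 + \<chi> a * \<chi> n \<le> 2" if "\<chi> \<in> X" for \<chi>
      using X_range[OF that, of a] X_range[OF that, of n] by auto
    have "(\<Prod>\<chi>\<in>X. 1 + \<chi> a * \<chi> n) \<le> (\<Prod>\<chi>\<in>X. 2)"
      by (intro prod_mono factor)
    moreover have "0 \<le> (\<Prod>\<chi>\<in>X. 1 + \<chi> a * \<chi> n)"
      using factor by (intro prod_nonneg) blast
    ultimately show "W n \<le> 2 ^ card X" "0 \<le> W n"
      by (auto simp: W_def)
  qed
  have W_prime: "W p = 0" if p: "prime p" for p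
  proof (cases "coprime p N")
    case True
    then obtain \<chi> where \<chi>: "\<chi> \<in> X" "\<chi> p \<noteq> \<chi> a"
      using no_prime p by blast
    then have "1 + \<chi> a * \<chi> p = 0"
      using X_coprime[OF \<chi>(1) True] X_coprime[OF \<chi>(1) assms(4)] by auto
    then show ?thesis
      unfolding W_def using \<chi>(1) assms(2) by (auto intro: prod_zero)
  qed (simp add: W_def)
  have upper: "(\<Sum>d\<in>{1..x}. W d * \<Lambda> d) \<le> 2 ^ card X * 2" for x
  proof -
    have "(\<Sum>d\<in>{1..x}. W d * \<Lambda> d) = (\<Sum>d | d \<in> {1..x} \<and> \<not> prime d. W d * \<Lambda> d)"
      by (rule sum.mono_neutral_right) (auto simp: W_prime)
    also have "\<dots> \<le> (\<Sum>d | d \<in> {1..x} \<and> \<not> prime d. 2 ^ card X * \<Lambda> d)"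
      using W_le \<Lambda>_nonneg by (intro sum_mono mult_right_mono) auto
    also have "\<dots> \<le> 2 ^ card X * 2"
      unfolding sum_distrib_left[symmetric] \<Lambda>_def
      by (intro mult_left_mono sum_mangoldt_over_prime_powers_le) simp
    finally show ?thesis .
  qed
  \<comment> \<open>One-sided bounds suffice: if \<open>\<psi> J\<close> takes the value -1 the sum
    is bounded, and otherwise all its terms are nonnegative. Only the empty \<open>J\<close> has to
    supply growth.\<close>
  have "\<exists>B. \<forall>x. (\<Sum>d\<in>{1..x}. \<psi> J a * \<psi> J d * \<Lambda> d) \<ge> - B" if "J \<subseteq> X" for J
  proof (cases "\<exists>c. \<psi> J c = -1")
    case True
    then interpret nonprincipal_quadratic_character N "\<psi> J"
      using \<psi>[OF that] by (simp add: nonprincipal_quadratic_character_def nonprincipal_quadratic_character_axioms_def)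
    obtain B where B: "\<bar>\<Sum>d\<in>{1..x}. \<psi> J d * \<Lambda> d\<bar> \<le> B" for x
      using sum_mangoldt_over_bounded unfolding \<Lambda>_def by blast
    have "(\<Sum>d\<in>{1..x}. \<psi> J a * \<psi> J d * \<Lambda> d) \<ge> - B" for x
      using B[of x] range[of a] by (auto simp: sum_negf)
    then show ?thesis by blast
  next
    case False
    have "\<psi> J d \<ge> 0" for d
      using quadratic_character.range[OF \<psi>[OF that], of d] False by auto
    then have "(\<Sum>d\<in>{1..x}. \<psi> J a * \<psi> J d * \<Lambda> d) \<ge> 0" for x
      using \<Lambda>_nonneg by (intro sum_nonneg mult_nonneg_nonneg) auto
    then show ?thesis by (metis neg_0_equal_iff_equal)
  qed
  then obtain B where B: "\<And>J x. J \<subseteq> X \<Longrightarrow> (\<Sum>d\<in>{1..x}. \<psi> J a * \<psi> J d * \<Lambda> d) \<ge> - B J"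
    by metis
  have lower: "(\<Sum>d\<in>{1..x}. W d * \<Lambda> d) \<ge> E x - (\<Sum>J\<in>Pow X - {{}}. B J)" for x
  proof -
    have "(\<Sum>d\<in>{1..x}. W d * \<Lambda> d) = (\<Sum>J\<in>Pow X. \<Sum>d\<in>{1..x}. \<psi> J a * \<psi> J d * \<Lambda> d)"
      unfolding W_eq sum_distrib_right by (rule sum.swap)
    also have "\<dots> = (\<Sum>d\<in>{1..x}. \<psi> {} a * \<psi> {} d * \<Lambda> d)
        + (\<Sum>J\<in>Pow X - {{}}. \<Sum>d\<in>{1..x}. \<psi> J a * \<psi> J d * \<Lambda> d)"
      using assms(2) by (intro sum.remove) auto
    also have "(\<Sum>d\<in>{1..x}. \<psi> {} a * \<psi> {} d * \<Lambda> d) = E x"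
      using assms(4) by (simp add: E_def \<psi>_def)
    finally have "(\<Sum>d\<in>{1..x}. W d * \<Lambda> d)
        = E x + (\<Sum>J\<in>Pow X - {{}}. \<Sum>d\<in>{1..x}. \<psi> J a * \<psi> J d * \<Lambda> d)" .
    moreover have "(\<Sum>J\<in>Pow X - {{}}. \<Sum>d\<in>{1..x}. \<psi> J a * \<psi> J d * \<Lambda> d) \<ge> (\<Sum>J\<in>Pow X - {{}}. - B J)"
      using B by (intro sum_mono) auto
    ultimately show ?thesis by (simp add: sum_negf)
  qed
  \<comment> \<open>Passing from \<open>E x\<close> to the full sum over \<open>d\<close> costs at
    most 2 for the non-primes and a fixed sum for the divisors of \<open>N\<close>.\<close>
  define C where "C = 2 ^ card X * 2 + (\<Sum>J\<in>Pow X - {{}}. B J) + 2 + (\<Sum>d\<in>{1..N}. \<Lambda> d)"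
  have bound: "ln (real x) - 1 \<le> C" if "x > 0" for x
  proof -
    have "ln (real x) - 1 \<le> (\<Sum>d\<in>{1..x}. \<Lambda> d)"
      unfolding \<Lambda>_def using that by (rule sum_mangoldt_over_ge)
    also have "\<dots> \<le> (\<Sum>d\<in>{1..x}. of_bool (coprime d N) * \<Lambda> d + of_bool (\<not> prime d) * \<Lambda> d
        + of_bool (d dvd N) * \<Lambda> d)"
    proof (rule sum_mono)
      fix d assume "d \<in> {1..x}"
      have "coprime d N \<or> \<not> prime d \<or> d dvd N"
        using prime_imp_coprime by blast
      then show "\<Lambda> d \<le> of_bool (coprime d N) * \<Lambda> d + of_bool (\<not> prime d) * \<Lambda> d + of_bool (d dvd N) * \<Lambda> d"
        using \<Lambda>_nonneg[of d] by auto
    qed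
    also have "\<dots> = E x + (\<Sum>d\<in>{1..x}. of_bool (\<not> prime d) * \<Lambda> d) + (\<Sum>d\<in>{1..x}. of_bool (d dvd N) * \<Lambda> d)"
      by (simp add: sum.distrib E_def)
    also have "(\<Sum>d\<in>{1..x}. of_bool (\<not> prime d) * \<Lambda> d) = (\<Sum>d | d \<in> {1..x} \<and> \<not> prime d. \<Lambda> d)"
      by (rule sum.mono_neutral_cong_right) auto
    also have "\<dots> \<le> 2"
      unfolding \<Lambda>_def by (rule sum_mangoldt_over_prime_powers_le)
    also have "(\<Sum>d\<in>{1..x}. of_bool (d dvd N) * \<Lambda> d) = (\<Sum>d | d \<in> {1..x} \<and> d dvd N. \<Lambda> d)"
      by (rule sum.mono_neutral_cong_right) auto
    also have "\<dots> \<le> (\<Sum>d\<in>{1..N}. \<Lambda> d)"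
      using assms(1) \<Lambda>_nonneg by (intro sum_mono2) (auto dest: dvd_imp_le)
    finally show ?thesis
      using lower[of x] upper[of x] unfolding C_def by linarith
  qed
  obtain x where x: "exp (C + 1) < real x"
    using reals_Archimedean2 by blast
  have "0 < real x"
    using exp_gt_zero x by (rule less_trans)
  then have "ln (exp (C + 1)) < ln (real x)"
    using x by (subst ln_less_cancel_iff) auto
  moreover have "ln (real x) - 1 \<le> C"
    using bound \<open>0 < real x\<close> by simp
  ultimately show False by simp
qed

section \<open>The auxiliary prime\<close>

text \<open>Euler's criterion gives only congruences; values in \<open>{-1, 0, 1}\<close> differ by
  at most 2, so a modulus above 2 separates them.\<close>

lemma Legendre_eqI:
  assumes "p > (2::int)" "[Legendre a p = e] (mod p)" "e \<in> {-1, 0, 1}"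
  shows "Legendre a p = e"
proof -
  have "p dvd Legendre a p - e"
    using assms(2) by (simp add: cong_iff_dvd_diff)
  moreover have "Legendre a p \<in> {-1, 0, 1}"
    by (simp add: Legendre_def)
  ultimately show ?thesis
    using assms(1,3) zdvd_imp_le[of p 1] zdvd_imp_le[of p 2] by auto
qed

lemma Legendre_mult:
  assumes "prime p" "2 < (p::nat)"
  shows "Legendre (a * b) p = Legendre a p * Legendre b p"
proof (rule Legendre_eqI)
  have "[a ^ ((p - 1) div 2) * b ^ ((p - 1) div 2) = Legendre a p * Legendre b p] (mod p)"
    by (intro cong_mult cong_sym[OF euler_criterion[OF assms]])
  with euler_criterion[OF assms, of "a * b"]
  show "[Legendre (a * b) p = Legendre a p * Legendre b p] (mod p)"
    unfolding power_mult_distrib by (rule cong_trans)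
  have "Legendre c p \<in> {-1, 0, 1}" for c
    by (simp add: Legendre_def)
  from this[of a] this[of b] show "Legendre a p * Legendre b p \<in> {-1, 0, 1}"
    by auto
qed (use assms in simp)

lemma Legendre_cong:
  assumes "[a = b] (mod p)"
  shows "Legendre a p = Legendre b p"
proof -
  have "[x = a] (mod p) \<longleftrightarrow> [x = b] (mod p)" for x
    using assms cong_trans cong_sym by blast
  moreover have "[a = 0] (mod p) \<longleftrightarrow> [b = 0] (mod p)"
    using assms cong_trans cong_sym by blast
  ultimately show ?thesis
    by (simp add: Legendre_def QuadRes_def)
qed

lemma Legendre_minus_1:
  assumes "prime p" "2 < (p::nat)"
  shows "Legendre (-1) p = (if p mod 4 = 1 then 1 else -1)"
proof (rule Legendre_eqI)
  have "odd p" using assms prime_odd_nat by blast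
  then have "even ((p - 1) div 2) \<longleftrightarrow> p mod 4 = 1" by presburger
  then show "[Legendre (-1) p = (if p mod 4 = 1 then 1 else -1)] (mod p)"
    using euler_criterion[OF assms, of "-1"] by (cases "p mod 4 = 1") (simp_all add: uminus_power_if)
qed (use assms in auto)

text \<open>With \<open>i\<^sup>2 = -1\<close> modulo \<open>q\<close>, the identity \<open>2 = -i (1 + i)\<^sup>2\<close> turns \<open>2\<close> to the power
  \<open>(q - 1) / 2\<close> into a power of \<open>-i\<close>.\<close>

lemma Legendre_2:
  assumes "prime q" "(q::nat) mod 4 = 1"
  shows "Legendre 2 q = (if q mod 8 = 1 then 1 else -1)"
proof (rule Legendre_eqI)
  have "q > 2" using assms prime_ge_2_nat[of q] by (cases "q = 2") auto
  then show "int q > 2" by simp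
  define m where "m = (q - 1) div 4"
  have q: "q = 4 * m + 1"
    using assms(2) unfolding m_def by presburger
  have "Legendre (-1) q = 1"
    using Legendre_minus_1[OF assms(1) \<open>q > 2\<close>] assms(2) by simp
  then obtain i where i: "[i^2 = -1] (mod q)"
    unfolding Legendre_def QuadRes_def by (auto split: if_splits)
  have "[2 = - i * (1 + i)^2] (mod q)"
  proof -
    have "2 - (- i * (1 + i)^2) = (i + 2) * (i^2 - (-1))"
      by (simp add: power2_eq_square algebra_simps)
    then show ?thesis
      using i by (metis cong_iff_dvd_diff dvd_mult)
  qed
  then have "[2^(2 * m) = (- i * (1 + i)^2)^(2 * m)] (mod q)"
    by (rule cong_pow)
  also have "(- i * (1 + i)^2)^(2 * m) = (i^2)^m * (1 + i)^(4 * m)"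
    by (simp add: power_mult_distrib flip: power_mult)
  also have "[\<dots> = (-1)^m * 1] (mod q)"
  proof (rule cong_mult)
    show "[(i^2)^m = (-1)^m] (mod q)" using i by (rule cong_pow)
    have "\<not> int q dvd 1 + i"
    proof
      assume "int q dvd 1 + i"
      then have "int q dvd (i - 1) * (1 + i)" by simp
      then have "int q dvd (i^2 - (-1)) - (i - 1) * (1 + i)"
        using i by (simp only: cong_iff_dvd_diff dvd_diff)
      moreover have "(i^2 - (-1)) - (i - 1) * (1 + i) = 2"
        by (simp add: power2_eq_square algebra_simps)
      ultimately have "int q dvd 2" by metis
      then show False using \<open>q > 2\<close> zdvd_imp_le[of q 2] by simp
    qed
    then have "Legendre (1 + i) q ^ 2 = 1"
      by (simp add: Legendre_def cong_0_iff)
    moreover have "[Legendre (1 + i) q ^ 2 = ((1 + i)^((q - 1) div 2))^2] (mod q)"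
      by (intro cong_pow euler_criterion) fact+
    moreover have "((1 + i)^((q - 1) div 2))^2 = (1 + i)^(4 * m)"
      unfolding q by (simp flip: power_mult)
    ultimately show "[(1 + i)^(4 * m) = 1] (mod q)" by (metis cong_sym)
  qed
  finally have "[2^((q - 1) div 2) = (-1)^m] (mod q)"
    using q by simp
  moreover have "even m \<longleftrightarrow> q mod 8 = 1"
    unfolding q by presburger
  ultimately show "[Legendre 2 q = (if q mod 8 = 1 then 1 else -1)] (mod q)"
    using euler_criterion[OF assms(1) \<open>q > 2\<close>, of 2]
    by (auto simp: uminus_power_if intro: cong_trans)
qed simp

lemma quadratic_reciprocity_1_mod_4:
  assumes "prime p" "prime q" "2 < p" "(q::nat) mod 4 = 1" "p \<noteq> q"
  shows "Legendre p q = Legendre q p"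
proof -
  have "2 < q" using assms prime_ge_2_nat[of q] by (cases "q = 2") auto
  moreover have "even ((q - 1) div 2)" using assms(4) by presburger
  ultimately have "Legendre p q * Legendre q p = 1"
    using Quadratic_Reciprocity[OF assms(1,3,2) _ assms(5)] by simp
  then show ?thesis
    by (auto simp: Legendre_def split: if_splits)
qed

lemma Legendre_dvd:
  assumes "Legendre a p = 1"
  shows "\<exists>s. p dvd s^2 - a"
  using assms unfolding Legendre_def QuadRes_def
  by (auto simp: cong_iff_dvd_diff split: if_splits)

text \<open>The symbol is lifted to a multiple \<open>N\<close> of \<open>p\<close>, so that
  characters for several primes share one modulus.\<close>

lemma quadratic_character_Legendre:
  assumes "prime p" "2 < (p::nat)" "p dvd N" "N > 0"
  shows "quadratic_character N (\<lambda>m. if coprime m N then real_of_int (Legendre m p) else 0)"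
proof
  show "N > 0" by fact
  have "Legendre 1 p = 1"
    using assms(2) zdvd_imp_le[of p 1]
    unfolding Legendre_def QuadRes_def by (auto simp: cong_iff_dvd_diff intro: exI[of _ 1])
  then show "(if coprime 1 N then real_of_int (Legendre (int 1) p) else 0) = 1" by simp
  show "(if coprime (m * n) N then real_of_int (Legendre (int (m * n)) p) else 0) =
     (if coprime m N then real_of_int (Legendre (int m) p) else 0) *
     (if coprime n N then real_of_int (Legendre (int n) p) else 0)" for m n
    using Legendre_mult[OF assms(1,2), of m n] by simp
  have "[int (n + N) = int n] (mod p)" for n
    using assms(3) by (simp add: cong_iff_dvd_diff)
  then show "(if coprime (n + N) N then real_of_int (Legendre (int (n + N)) p) else 0) =
      (if coprime n N then real_of_int (Legendre (int n) p) else 0)" for n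
    using Legendre_cong[of "int (n + N)" "int n" p] by (simp only: coprime_iff_gcd_eq_1 gcd_add1)
  show "(if coprime n N then real_of_int (Legendre (int n) p) else 0) = 1 \<or>
      (if coprime n N then real_of_int (Legendre (int n) p) else 0) = -1" if "coprime n N" for n
  proof -
    have "\<not> p dvd n"
      using that assms(1,3) by (meson coprime_common_divisor_nat not_prime_1 coprime_common_divisor not_prime_unit)
    then show ?thesis
      using that by (auto simp: Legendre_def cong_iff_dvd_diff)
  qed
qed simp

text \<open>The characters attached to -1 and to 2; together they determine an odd number modulo
  8.\<close>

lemma quadratic_character_mod_8:
  assumes "8 dvd N" "N > 0" "R = {1, 5} \<or> R = {1, (7::nat)}"
  shows "quadratic_character N (\<lambda>m. if coprime m N then if m mod 8 \<in> R then 1 else - 1 else 0)"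
proof
  have odd_if: "odd m" if "coprime m N" for m
    using that assms(1) by (metis coprime_common_divisor dvd_trans even_numeral odd_one)
  then have odd: "m mod 8 = 1 \<or> m mod 8 = 3 \<or> m mod 8 = 5 \<or> m mod 8 = 7" if "coprime m N" for m
    using odd_if[OF that] by presburger
  show "(if coprime (m * n) N then if m * n mod 8 \<in> R then 1 else - 1 else 0) =
       (if coprime m N then if m mod 8 \<in> R then 1 else - 1 else 0) *
       (if coprime n N then if n mod 8 \<in> R then 1 else - 1 else (0::real))" for m n
  proof (cases "coprime m N \<and> coprime n N")
    case True
    have "(m * n) mod 8 = (m mod 8 * (n mod 8)) mod 8"
      by (simp add: mod_mult_eq)
    moreover have "m mod 8 = 1 \<or> m mod 8 = 3 \<or> m mod 8 = 5 \<or> m mod 8 = 7"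
      "n mod 8 = 1 \<or> n mod 8 = 3 \<or> n mod 8 = 5 \<or> n mod 8 = 7"
      using True odd by blast+
    ultimately show ?thesis
      using True assms(3) by (elim disjE) simp_all
  qed auto
  have "(n + N) mod 8 = n mod 8" for n
    using assms(1) by (simp add: mod_eq_0_iff_dvd flip: mod_add_right_eq[of _ N])
  then show "(if coprime (n + N) N then if (n + N) mod 8 \<in> R then 1 else - 1 else 0) =
       (if coprime n N then if n mod 8 \<in> R then 1 else - 1 else (0::real))" for n
    by (simp only: coprime_iff_gcd_eq_1 gcd_add1)
  show "N > 0" by fact
  show "(if coprime 1 N then if 1 mod 8 \<in> R then 1 else - 1 else (0::real)) = 1"
    using assms(3) by auto
  show "(if coprime n N then if n mod 8 \<in> R then 1 else - 1 else (0::real)) = 1 \<or>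
        (if coprime n N then if n mod 8 \<in> R then 1 else - 1 else (0::real)) = - 1"
    if "coprime n N" for n
    using that by (cases "n mod 8 \<in> R") simp_all
  show "(if coprime n N then if n mod 8 \<in> R then 1 else - 1 else (0::real)) = 0"
    if "\<not> coprime n N" for n
    using that by simp
qed

text \<open>A residue \<open>a\<close> that is -1 modulo \<open>3 * n\<close> is realised by a prime
  \<open>q\<close> up to quadratic characters. Then \<open>-q\<close> is a square modulo each prime
  factor of \<open>n\<close>, and \<open>q\<close> is 2 modulo 3. Reciprocity for \<open>q\<close>
  congruent to 1 modulo 4 evaluates the symbol of \<open>-6 * n\<close> modulo
  \<open>q\<close>.\<close>

lemma exists_auxiliary_prime:
  fixes n :: nat
  assumes "n > 0" "odd n" "\<not> 3 dvd n"
  shows "\<exists>q b. prime q \<and> odd q \<and> q mod 3 = 2 \<and> \<not> q dvd n \<and> int q dvd b^2 + 6 * int n \<and>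
    (\<forall>p. prime p \<longrightarrow> p dvd n \<longrightarrow> (\<exists>s. int p dvd s^2 + int q))"
proof -
  define N where "N = 8 * (3 * n)"
  \<comment> \<open>Both values are 1 modulo 4. The residue modulo 8 is chosen so that the symbols
    of 2 and \<open>n\<close> modulo \<open>q\<close> are opposite, which compensates the symbol -1
    of 3.\<close>
  define e :: nat where "e = (if n mod 4 = 1 then 5 else 1)"
  define P where "P = {p. prime p \<and> p dvd 3 * n}"
  define LL where "LL = (\<lambda>p m. if coprime m N then real_of_int (Legendre (int m) (int p)) else 0)"
  define ch where "ch = (\<lambda>R m. if coprime m N then if m mod 8 \<in> R then 1 else - 1 else (0::real))"
  define X where "X = LL ` P \<union> {ch {1, 5}, ch {1, (7::nat)}}"
  have "N > 0" "8 dvd N" using assms(1) by (simp_all add: N_def)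
  have P_odd: "p > 2" if "p \<in> P" for p
  proof -
    have "odd (3 * n)" using assms(2) by simp
    then have "p \<noteq> 2" using that unfolding P_def by auto
    then show ?thesis using that prime_ge_2_nat[of p] unfolding P_def by auto
  qed
  have "finite P"
    unfolding P_def using assms(1) by (intro finite_subset[OF _ finite_divisors_nat[of "3 * n"]]) auto
  then have "finite X" by (simp add: X_def)
  have X: "quadratic_character N \<chi>" if "\<chi> \<in> X" for \<chi>
  proof -
    have "p dvd N" if "p \<in> P" for p
      using that unfolding P_def N_def by (blast intro: dvd_mult)
    then show ?thesis
      using that quadratic_character_Legendre[of _ N] P_odd \<open>N > 0\<close>
        quadratic_character_mod_8[OF \<open>8 dvd N\<close> \<open>N > 0\<close>]
      unfolding X_def LL_def ch_def by (auto simp: P_def)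
  qed
  have eight: "(8::nat) = 2 ^ 3" by simp
  have "coprime (8::nat) (3 * n)"
    unfolding eight coprime_power_left_iff using assms(2) by simp
  then obtain a where a: "[a = e] (mod 8)" "[a = 3 * n - 1] (mod (3 * n))"
    using binary_chinese_remainder_nat by blast
  have a8: "a mod 8 = e"
    using a(1) by (auto simp: cong_def e_def split: if_splits)
  have a_dvd: "3 * n dvd a + 1"
  proof -
    have "[a + 1 = (3 * n - 1) + 1] (mod (3 * n))"
      using a(2) by (rule cong_add) simp
    then show ?thesis
      using assms(1) by (simp add: cong_def mod_eq_0_iff_dvd)
  qed
  have "coprime a (3 * n)"
    using a_dvd by (metis coprime_Suc_right_nat coprime_divisors dvd_refl Suc_eq_plus1)
  moreover have "odd a"
    using a8 unfolding e_def by (auto split: if_splits; presburger)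
  then have "coprime a 8"
    unfolding eight coprime_power_right_iff by simp
  ultimately have "coprime a N"
    by (metis N_def coprime_mult_right_iff)
  then obtain q where q: "prime q" "coprime q N" "\<And>\<chi>. \<chi> \<in> X \<Longrightarrow> \<chi> q = \<chi> a"
    using prime_with_prescribed_characters[OF \<open>N > 0\<close> \<open>finite X\<close> X] by blast
  have q_leg: "Legendre (int q) (int p) = Legendre (-1) (int p)" if "p \<in> P" for p
  proof -
    have "LL p q = LL p a"
      using q(3) that by (simp add: X_def)
    then have "Legendre (int q) (int p) = Legendre (int a) (int p)"
      using \<open>coprime q N\<close> \<open>coprime a N\<close> by (simp add: LL_def)
    moreover have "p dvd a + 1"
      using that a_dvd unfolding P_def by (auto intro: dvd_trans)
    then have "[int a = -1] (mod int p)"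
      by (simp add: cong_iff_dvd_diff) (metis int_dvd_int_iff of_nat_Suc Suc_eq_plus1 add.commute)
    ultimately show ?thesis
      using Legendre_cong by metis
  qed
  have "odd q"
    using \<open>coprime q N\<close> \<open>8 dvd N\<close> by (metis coprime_common_divisor dvd_trans even_numeral odd_one)
  have q8: "q mod 8 = e"
  proof -
    have "ch {1, 5} q = ch {1, 5} a" "ch {1, 7} q = ch {1, 7} a"
      using q(3) by (simp_all add: X_def)
    moreover have "q mod 8 = 1 \<or> q mod 8 = 3 \<or> q mod 8 = 5 \<or> q mod 8 = 7"
      using \<open>odd q\<close> by presburger
    ultimately show ?thesis
      using \<open>coprime q N\<close> \<open>coprime a N\<close> a8 by (auto simp: ch_def e_def split: if_splits)
  qed
  then have q4: "q mod 4 = 1"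
    unfolding e_def by (auto split: if_splits; presburger)
  have "q > 2" using \<open>odd q\<close> \<open>prime q\<close> prime_ge_2_nat[of q] by (cases "q = 2") auto
  have "\<not> q dvd 3 * n"
    using q(1,2) unfolding N_def
    by (metis coprime_common_divisor coprime_mult_right_iff dvd_refl not_prime_unit)
  have "prime (3::nat)" by simp
  then have "3 \<in> P" by (simp add: P_def)
  have L3: "Legendre (int q) 3 = -1"
    using q_leg[OF \<open>3 \<in> P\<close>] Legendre_minus_1[of 3] \<open>prime (3::nat)\<close> by simp
  have q3: "q mod 3 = 2"
  proof -
    have "\<not> 3 dvd q"
      using L3 by (auto simp: Legendre_def cong_0_iff split: if_splits)
    moreover have "q mod 3 \<noteq> 1"
    proof
      assume "q mod 3 = 1"
      then have "[int q = 1] (mod 3)" by (auto simp: cong_def) presburger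
      then have "QuadRes 3 (int q)"
        unfolding QuadRes_def using cong_sym by (intro exI[of _ 1]) auto
      then show False using L3 by (auto simp: Legendre_def split: if_splits)
    qed
    ultimately show ?thesis by presburger
  qed
  \<comment> \<open>For a prime factor \<open>p\<close>, reciprocity gives the symbol of
    \<open>q\<close> modulo \<open>p\<close>, which is that of -1; both sides are multiplicative in
    \<open>m\<close>.\<close>
  have Ln: "Legendre (int m) (int q) = (if m mod 4 = 1 then 1 else -1)" if "m dvd n" for m
    using that
  proof (induction m rule: prime_divisors_induct)
    case zero
    then show ?case using assms(1) by simp
  next
    case (unit u)
    have "[(1::int) \<noteq> 0] (mod q)" using \<open>q > 2\<close> by (simp add: cong_def)
    then show ?case
      using unit unfolding Legendre_def QuadRes_def by (auto intro: exI[of _ 1])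
  next
    case (factor p m)
    have "p dvd n" "m dvd n"
      using factor.prems by (auto intro: dvd_trans[of _ "p * m"])
    then have "odd p" "odd m" using assms(2) by (meson dvd_trans)+
    have "p \<in> P" using \<open>p dvd n\<close> factor.hyps by (simp add: P_def)
    have "p \<noteq> q" using \<open>p dvd n\<close> \<open>\<not> q dvd 3 * n\<close> by auto
    have "Legendre (int p) (int q) = (if p mod 4 = 1 then 1 else -1)"
      using quadratic_reciprocity_1_mod_4[OF factor.hyps q(1) P_odd[OF \<open>p \<in> P\<close>] q4 \<open>p \<noteq> q\<close>]
        q_leg[OF \<open>p \<in> P\<close>] Legendre_minus_1[OF factor.hyps P_odd[OF \<open>p \<in> P\<close>]] by simp
    moreover have "p mod 4 = 1 \<or> p mod 4 = 3" "m mod 4 = 1 \<or> m mod 4 = 3"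
      using \<open>odd p\<close> \<open>odd m\<close> by presburger+
    moreover have "(p * m) mod 4 = (p mod 4 * (m mod 4)) mod 4"
      by (simp add: mod_mult_eq)
    ultimately show ?case
      using factor.IH[OF \<open>m dvd n\<close>] Legendre_mult[OF q(1) \<open>q > 2\<close>, of p m] by auto
  qed
  have "Legendre (-1 * 2 * 3 * int n) (int q) = 1"
  proof -
    have "3 \<noteq> q" using \<open>\<not> q dvd 3 * n\<close> by auto
    then have "Legendre 3 (int q) = -1"
      using quadratic_reciprocity_1_mod_4[OF \<open>prime (3::nat)\<close> q(1) _ q4] L3 by simp
    moreover have "Legendre (-1 * 2 * 3 * int n) (int q) =
        Legendre (-1) q * Legendre 2 q * Legendre 3 q * Legendre n q"
      by (simp only: Legendre_mult[OF q(1) \<open>q > 2\<close>])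
    ultimately show ?thesis
      using Legendre_minus_1[OF q(1) \<open>q > 2\<close>] q4
        Legendre_2[OF q(1) q4] Ln[of n] q8 by (simp add: e_def split: if_splits)
  qed
  then obtain b where b: "int q dvd b^2 + 6 * int n"
    using Legendre_dvd by fastforce
  have "\<exists>s. int p dvd s^2 + int q" if "prime p" "p dvd n" for p
  proof -
    have "p \<in> P" using that by (simp add: P_def)
    have "Legendre (-1 * int q) (int p) = 1"
      using Legendre_mult[OF that(1) P_odd[OF \<open>p \<in> P\<close>], of "-1" q] q_leg[OF \<open>p \<in> P\<close>]
        Legendre_minus_1[OF that(1) P_odd[OF \<open>p \<in> P\<close>]] by simp
    then show ?thesis using Legendre_dvd by fastforce
  qed
  then show ?thesis
    using q(1) \<open>odd q\<close> q3 \<open>\<not> q dvd 3 * n\<close> b by (metis dvd_mult)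
qed

section \<open>Representations by the quaternary form\<close>

lemma form_1_2_3_represents:
  fixes n :: int
  assumes "n > 0" "odd n" "\<not> 3 dvd n"
  shows "\<exists>x y z. n = x^2 + 2 * y^2 + 3 * z^2"
proof -
  define s where "s = squarefree_part n"
  define m where "m = square_part n"
  have n: "n = s * m^2"
    unfolding s_def m_def by (rule squarefree_decompose)
  have "s > 0"
    using assms(1) unfolding n by (simp add: zero_less_mult_iff)
  have "odd s" "\<not> 3 dvd s" using assms unfolding n by auto
  have "squarefree s"
    unfolding s_def by (rule squarefree_squarefree_part)
  define k where "k = nat s"
  have s: "s = int k" using \<open>s > 0\<close> by (simp add: k_def)
  have "k > 0" "odd k" "\<not> 3 dvd k"
    using \<open>s > 0\<close> \<open>odd s\<close> \<open>\<not> 3 dvd s\<close> unfolding s by (auto simp: int_dvd_int_iff[of 3, simplified])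
  then obtain q b where q: "prime q" "odd q" "q mod 3 = 2" "\<not> q dvd k" "int q dvd b^2 + 6 * int k"
    "\<And>p. prime p \<Longrightarrow> p dvd k \<Longrightarrow> \<exists>r. int p dvd r^2 + int q"
    using exists_auxiliary_prime by metis
  have "\<exists>x y z. s = x^2 + 2 * y^2 + 3 * z^2"
  proof (rule form_1_2_3_from_prime[OF \<open>s > 0\<close> \<open>odd s\<close> \<open>squarefree s\<close> \<open>\<not> 3 dvd s\<close>])
    show "prime (int q)" "odd (int q)" "\<not> int q dvd s" "int q dvd b^2 + 6 * s"
      using q unfolding s by simp_all
    show "int q mod 3 = 2"
      using q(3) by presburger
    show "\<exists>r. p dvd r^2 + int q" if "prime p" "p dvd s" for p
    proof -
      have "p = int (nat p)" using prime_gt_0_int[OF that(1)] by simp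
      then show ?thesis
        using q(6)[of "nat p"] that unfolding s by (metis int_dvd_int_iff prime_nat_int_transfer)
    qed
  qed
  then obtain x y z where "s = x^2 + 2 * y^2 + 3 * z^2" by blast
  then have "n = (x * m)^2 + 2 * (y * m)^2 + 3 * (z * m)^2"
    unfolding n by (simp add: power_mult_distrib algebra_simps)
  then show ?thesis by blast
qed

lemma form_1_2_3_3_represents:
  fixes n :: int
  assumes "n \<ge> 0"
  shows "\<exists>x y z w. n = x^2 + 2 * y^2 + 3 * (z^2 + z * w + w^2)"
  using assms
proof (induction "nat n" arbitrary: n rule: less_induct)
  case less
  consider (zero) "n = 0" | (three) "n > 0" "3 dvd n" | (odd) "n > 0" "\<not> 3 dvd n" "odd n"
    | (even) "n \<ge> 9" "\<not> 3 dvd n" "even n" | (small) "n = 2 \<or> n = 4 \<or> n = 8"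
  proof -
    have "n = 0 \<or> n > 0 \<and> 3 dvd n \<or> n > 0 \<and> \<not> 3 dvd n \<and> odd n
        \<or> n \<ge> 9 \<and> \<not> 3 dvd n \<and> even n \<or> n = 2 \<or> n = 4 \<or> n = 8"
      using less.prems by presburger
    then show thesis using that by blast
  qed
  then show ?case
  proof cases
    case zero
    then show ?thesis by (intro exI[of _ 0]) simp
  next
    case three
    then obtain m where m: "n = 3 * m" by blast
    then obtain x y z w where xyzw: "m = x^2 + 2 * y^2 + 3 * (z^2 + z * w + w^2)"
      using less.hyps[of m] three by auto
    \<comment> \<open>Both \<open>x^2 + 2 * y^2\<close> and \<open>z^2 + z * w + w^2\<close> are
      norm forms that represent 3, so multiplication by an element of norm 3 acts on each.\<close>
    have "n = (x + 2 * y)^2 + 2 * (x - y)^2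
        + 3 * ((z - w)^2 + (z - w) * (z + 2 * w) + (z + 2 * w)^2)"
      unfolding m xyzw by (simp add: power2_eq_square algebra_simps)
    then show ?thesis by blast
  next
    case odd
    then obtain x y z where "n = x^2 + 2 * y^2 + 3 * z^2"
      using form_1_2_3_represents by blast
    then show ?thesis
      by (intro exI[of _ x] exI[of _ y] exI[of _ z] exI[of _ 0]) simp
  next
    case even
    \<comment> \<open>The 9 is put back through
      \<open>z^2 + 3 = (z - 1)^2 + (z - 1) * 2 + 2^2\<close>.\<close>
    then have "n - 9 > 0" "odd (n - 9)" "\<not> 3 dvd n - 9" by presburger+
    then obtain x y z where "n - 9 = x^2 + 2 * y^2 + 3 * z^2"
      using form_1_2_3_represents by blast
    then have "n = x^2 + 2 * y^2 + 3 * ((z - 1)^2 + (z - 1) * 2 + 2^2)"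
      by (simp add: power2_eq_square algebra_simps)
    then show ?thesis by blast
  next
    case small
    moreover have "(2::int) = 0^2 + 2 * 1^2 + 3 * (0^2 + 0 * 0 + 0^2)"
      "(4::int) = 2^2 + 2 * 0^2 + 3 * (0^2 + 0 * 0 + 0^2)"
      "(8::int) = 0^2 + 2 * 2^2 + 3 * (0^2 + 0 * 0 + 0^2)" by simp_all
    ultimately show ?thesis by metis
  qed
qed

section \<open>Necessity of \<open>a = 1\<close> and \<open>b = 2\<close>, and the
  equivalence\<close>

lemma hexagonal_form_nonneg: "(z::int)^2 + z * w + w^2 \<ge> 0"
proof -
  have "4 * (z^2 + z * w + w^2) = (2 * z + w)^2 + 3 * w^2"
    by (simp add: power2_eq_square algebra_simps)
  then show ?thesis by (smt (verit) zero_le_power2)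
qed

lemma nonzero_square_ge_1: "(x::int) \<noteq> 0 \<Longrightarrow> x^2 \<ge> 1"
  using zero_less_power2[of x] by linarith

theorem theorem5p3:
  fixes a b :: int
  assumes "0 < a" and "a \<le> b"
  shows "(\<forall>n::int. n \<ge> 0 \<longrightarrow>
            (\<exists>x y z w :: int. n = a * x^2 + b * y^2 + 3 * (z^2 + z * w + w^2)))
         \<longleftrightarrow> (a = 1 \<and> b = 2)"
proof (intro iffI)
  assume universal: "\<forall>n::int. n \<ge> 0 \<longrightarrow>
    (\<exists>x y z w :: int. n = a * x^2 + b * y^2 + 3 * (z^2 + z * w + w^2))"
  have large: "c * x^2 \<ge> c" if "c > 0" "x \<noteq> 0" for c x :: int
    using that nonzero_square_ge_1[of x] mult_left_mono[of 1 "x^2" c] by simp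
  \<comment> \<open>If both coefficients exceed 1, the value 1 would have to be a multiple of
    3.\<close>
  have "a = 1"
  proof (rule ccontr)
    assume "a \<noteq> 1"
    obtain x y z w where eq: "1 = a * x^2 + b * y^2 + 3 * (z^2 + z * w + w^2)"
      using universal by (metis zero_le_one)
    have "a * x^2 \<ge> 0" "b * y^2 \<ge> 0" using assms by simp_all
    then have "a * x^2 \<le> 1" and "b * y^2 \<le> 1"
      using eq hexagonal_form_nonneg[of z w] by (smt (verit))+
    then have "x = 0" "y = 0"
      using large[of a x] large[of b y] assms \<open>a \<noteq> 1\<close> by fastforce+
    then show False using eq by simp presburger
  qed
  \<comment> \<open>For \<open>b > 2\<close> the value 2 forces \<open>y = 0\<close>, and then 2
    would be a square modulo 3.\<close>
  moreover have "b \<le> 2"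
  proof (rule ccontr)
    assume "\<not> b \<le> 2"
    obtain x y z w where eq: "2 = a * x^2 + b * y^2 + 3 * (z^2 + z * w + w^2)"
      using universal by (metis zero_le_numeral)
    have "a * x^2 \<ge> 0" using assms by simp
    then have "b * y^2 \<le> 2"
      using eq hexagonal_form_nonneg[of z w] by (smt (verit))
    then have "y = 0"
      using large[of b y] \<open>\<not> b \<le> 2\<close> by fastforce
    then have "2 = x^2 + 3 * (z^2 + z * w + w^2)"
      using eq \<open>a = 1\<close> by simp
    then have "x^2 mod 3 = 2"
      by presburger
    then show False
      using square_mod_3[of x] by (simp split: if_splits)
  qed
  \<comment> \<open>For \<open>a = b = 1\<close> consider the value 6: 3 divides \<open>x\<close>
    and \<open>y\<close>, hence both vanish by size, and the hexagonal form would take the value 2.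
    Its even values are multiples of 4.\<close>
  moreover have "b \<noteq> 1"
  proof
    assume "b = 1"
    obtain x y z w where "6 = a * x^2 + b * y^2 + 3 * (z^2 + z * w + w^2)"
      using universal by (metis zero_le_numeral)
    then have eq: "6 = x^2 + y^2 + 3 * (z^2 + z * w + w^2)"
      using \<open>a = 1\<close> \<open>b = 1\<close> by simp
    then have "x^2 + y^2 = 3 * (2 - (z^2 + z * w + w^2))" by simp
    then have "(x^2 + y^2) mod 3 = 0" by simp
    then have "(x^2 mod 3 + y^2 mod 3) mod 3 = 0" by presburger
    then have "3 dvd x" "3 dvd y"
      using square_mod_3[of x] square_mod_3[of y] by (auto split: if_splits)
    then obtain x' y' where x': "x = 3 * x'" and y': "y = 3 * y'" by (elim dvdE)
    have "6 = 9 * x'^2 + 9 * y'^2 + 3 * (z^2 + z * w + w^2)"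
      using eq unfolding x' y' by (simp add: power_mult_distrib)
    then have "x'^2 < 1" and "y'^2 < 1"
      using hexagonal_form_nonneg[of z w] zero_le_power2[of x'] zero_le_power2[of y']
      by (smt (verit))+
    then have "x' = 0" "y' = 0"
      using nonzero_square_ge_1[of x'] nonzero_square_ge_1[of y'] by fastforce+
    then have two: "z^2 + z * w + w^2 = 2"
      using eq x' y' by simp
    then have "even (z^2 + z * w + w^2)" by simp
    then have "even z" "even w" by auto
    then obtain z' w' where "z = 2 * z'" "w = 2 * w'" by (elim dvdE)
    then have "4 * (z'^2 + z' * w' + w'^2) = 2"
      using two by (simp add: power2_eq_square algebra_simps)
    then show False by presburger
  qed
  ultimately show "a = 1 \<and> b = 2"
    using assms by auto
next
  assume "a = 1 \<and> b = 2"
  then show "\<forall>n::int. n \<ge> 0 \<longrightarrow>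
    (\<exists>x y z w :: int. n = a * x^2 + b * y^2 + 3 * (z^2 + z * w + w^2))"
    using form_1_2_3_3_represents by simp
qed

end
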